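(* For every $p\ge1$ and $\alpha\in(0,1)$ there is a constant $C_{p,\alpha}$ depending only on $p$ and $\alpha$ such that the following holds. Let $F_G$ be the depth-$p$ QAOA MaxCut objective of a graph $G$, let $\mu\in\mathbb{R}^{2p}$, $\Sigma=\mathrm{diag}(\sigma_1^2,\dots,\sigma_{2p}^2)$ with all $\sigma_j>0$, and $\mathcal{T}_\alpha=\{\theta\in\mathbb{R}^{2p}:(\theta-\mu)^\top\Sigma^{-1}(\theta-\mu)\le\chi^2_{2p}(\alpha)\}$. Assume $F_G$ is three times continuously differentiable in a neighborhood of $\mathcal{T}_\alpha$, that $\lambda_{\min}(-\nabla^2F_G(\mu))\ge\kappa>0$, and that the third-order partial derivatives of $F_G$ are bounded in absolute value by $M_3$ there. Put $\Lambda:=\|\nabla^2F_G(\mu)\|_{\mathrm{op}}$, $\sigma_{\min}=\min_j\sigma_j$, $\sigma_{\max}=\max_j\sigma_j$. Then for $\theta\sim\mathrm{Unif}(\mathcal{T}_\alpha)$ and every $j\in\{1,\dots,2p\}$, $$\mathrm{Var}_{\theta\sim\mathrm{Unif}(\mathcal{T}_\alpha)}\bigl[\partial_jF_G(\theta)\bigr]\ \ge\ \frac{\kappa^2\sigma_{\min}^2\,\chi^2_{2p}(\alpha)}{2p+2}-C_{p,\alpha}\bigl(\Lambda M_3\sigma_{\max}^3+M_3^2\sigma_{\max}^4\bigr).$$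
   Context: $G=(V,E)$ is a finite simple unweighted graph with $|V|=n$. On $(\mathbb{C}^2)^{\otimes n}$ let $Z_i,X_i$ be Pauli operators on qubit $i$, $C=\sum_{(i,j)\in E}\frac12(I-Z_iZ_j)$, $B=\sum_iX_i$. For $\theta=(\gamma,\beta)\in\mathbb{R}^{2p}$, $|\theta\rangle=e^{-i\beta_pB}e^{-i\gamma_pC}\cdots e^{-i\beta_1B}e^{-i\gamma_1C}|+\rangle^{\otimes n}$ and $F_G(\theta)=\langle\theta|C|\theta\rangle$. $\chi^2_{2p}(\alpha)$ is the $\alpha$-quantile of the chi-square distribution with $2p$ degrees of freedom. $\mathrm{Unif}(\mathcal{T}_\alpha)$ is the uniform (normalized Lebesgue) distribution on $\mathcal{T}_\alpha$, and $\lambda_{\min}$ denotes the smallest eigenvalue. *)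

theory Defs
  imports "Jordan_Normal_Form.Matrix" "HOL-Probability.Probability"
begin

text \<open>
  Quantum states and operators on \<open>n\<close> qubits are complex vectors and matrices of dimension
  \<open>2 ^ n\<close>, written in the computational basis: bit \<open>i\<close> of the basis index \<open>r < 2 ^ n\<close> is the
  value of qubit \<open>i < n\<close>.
\<close>

definition tensor_mat :: "nat \<Rightarrow> (nat \<Rightarrow> complex Matrix.mat) \<Rightarrow> complex Matrix.mat" where
  "tensor_mat n A = Matrix.mat (2 ^ n) (2 ^ n)
     (\<lambda>(r, c). \<Prod>i<n. A i $$ (of_bool (bit r i), of_bool (bit c i)))"

definition tensor_vec :: "nat \<Rightarrow> (nat \<Rightarrow> complex Matrix.vec) \<Rightarrow> complex Matrix.vec" where
  "tensor_vec n v = Matrix.vec (2 ^ n) (\<lambda>r. \<Prod>i<n. vec_index (v i) (of_bool (bit r i)))"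

definition pauli_X :: "complex Matrix.mat" where
  "pauli_X = mat_of_rows_list 2 [[0, 1], [1, 0]]"

definition pauli_Z :: "complex Matrix.mat" where
  "pauli_Z = mat_of_rows_list 2 [[1, 0], [0, -1]]"

definition ket_plus :: "complex Matrix.vec" where
  "ket_plus = vec_of_list [1 / sqrt 2, 1 / sqrt 2]"

definition on_qubit :: "nat \<Rightarrow> complex Matrix.mat \<Rightarrow> nat \<Rightarrow> complex Matrix.mat" where
  "on_qubit n A i = tensor_mat n (\<lambda>k. if k = i then A else 1\<^sub>m 2)"

definition sum_of_mats :: "nat \<Rightarrow> ('a \<Rightarrow> complex Matrix.mat) \<Rightarrow> 'a set \<Rightarrow> complex Matrix.mat" where
  "sum_of_mats d f S = Matrix.mat d d (\<lambda>rc. \<Sum>a\<in>S. f a $$ rc)"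

definition mat_exp :: "complex Matrix.mat \<Rightarrow> complex Matrix.mat" where
  "mat_exp A = Matrix.mat (dim_row A) (dim_row A) (\<lambda>rc. \<Sum>k. (A ^\<^sub>m k) $$ rc / fact k)"

text \<open>The vertex set is \<open>{..<n}\<close>, and vertex \<open>i\<close> is qubit \<open>i\<close>.\<close>

definition simple_graph :: "nat \<Rightarrow> nat set set \<Rightarrow> bool" where
  "simple_graph n E \<longleftrightarrow> (\<forall>e\<in>E. e \<subseteq> {..<n} \<and> card e = 2)"

text \<open>Restricting to \<open>i < j\<close> makes each undirected edge contribute exactly once.\<close>

definition cut_operator :: "nat \<Rightarrow> nat set set \<Rightarrow> complex Matrix.mat" where
  "cut_operator n E = sum_of_mats (2 ^ n)
     (\<lambda>(i, j). (1 / 2) \<cdot>\<^sub>m (1\<^sub>m (2 ^ n) - on_qubit n pauli_Z i * on_qubit n pauli_Z j))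
     {(i, j). i < j \<and> {i, j} \<in> E}"

definition mixer_operator :: "nat \<Rightarrow> complex Matrix.mat" where
  "mixer_operator n = sum_of_mats (2 ^ n) (on_qubit n pauli_X) {..<n}"

text \<open>
  The layers are indexed by a finite linearly ordered type \<open>'p\<close>, so that the depth is \<open>CARD('p)\<close>,
  and the parameter space \<open>\<real>\<^sup>2\<^sup>p\<close> is \<open>real ^ ('p + 'p)\<close>: the components of
  \<open>\<theta> = (\<gamma>, \<beta>)\<close> are \<open>\<gamma>\<^sub>k = vec_nth \<theta> (Inl k)\<close> and \<open>\<beta>\<^sub>k = vec_nth \<theta> (Inr k)\<close>.
  Since \<^const>\<open>fold\<close> starts at the head of the list, the smallest layer acts first.
\<close>

definition qaoa_state ::
  "nat \<Rightarrow> nat set set \<Rightarrow> real ^ ('p::{finite,linorder} + 'p) \<Rightarrow> complex Matrix.vec" where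
  "qaoa_state n E \<theta> =
     fold (\<lambda>k \<psi>. mat_exp ((- \<i> * of_real (vec_nth \<theta> (Inr k))) \<cdot>\<^sub>m mixer_operator n) *\<^sub>v
                 (mat_exp ((- \<i> * of_real (vec_nth \<theta> (Inl k))) \<cdot>\<^sub>m cut_operator n E) *\<^sub>v \<psi>))
          (sorted_list_of_set (UNIV :: 'p set))
          (tensor_vec n (\<lambda>_. ket_plus))"

text \<open>
  \<^const>\<open>cscalar_prod\<close> conjugates its second argument, so the expression below is
  \<open>\<langle>\<theta>|C|\<theta>\<rangle>\<close>, which is real because \<open>C\<close> is Hermitian.
\<close>

definition qaoa_objective ::
  "nat \<Rightarrow> nat set set \<Rightarrow> real ^ ('p::{finite,linorder} + 'p) \<Rightarrow> real" where
  "qaoa_objective n E \<theta> = Re ((cut_operator n E *\<^sub>v qaoa_state n E \<theta>) \<bullet>c qaoa_state n E \<theta>)"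

definition partial_deriv :: "'d::finite \<Rightarrow> (real ^ 'd \<Rightarrow> real) \<Rightarrow> real ^ 'd \<Rightarrow> real" where
  "partial_deriv j f x = deriv (\<lambda>t. f (x + t *\<^sub>R axis j 1)) 0"

text \<open>To be used for open \<open>U\<close> only.\<close>

primrec Ck_on :: "nat \<Rightarrow> (real ^ 'd::finite \<Rightarrow> real) \<Rightarrow> (real ^ 'd) set \<Rightarrow> bool" where
  "Ck_on 0 f U \<longleftrightarrow> continuous_on U f"
| "Ck_on (Suc k) f U \<longleftrightarrow> f differentiable_on U \<and> (\<forall>j. Ck_on k (partial_deriv j f) U)"

definition hessian :: "(real ^ 'd::finite \<Rightarrow> real) \<Rightarrow> real ^ 'd \<Rightarrow> real ^ 'd ^ 'd" where
  "hessian f x = (\<chi> i j. partial_deriv i (partial_deriv j f) x)"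

text \<open>
  Intended for symmetric matrices, whose real eigenvalues form a finite nonempty set.
\<close>

definition lambda_min :: "real ^ 'd ^ 'd::finite \<Rightarrow> real" where
  "lambda_min A = Min {l. \<exists>v. v \<noteq> 0 \<and> A *v v = l *\<^sub>R v}"

text \<open>The covariance matrix \<open>diag(\<sigma>\<^sub>1\<^sup>2, \<sigma>\<^sub>2\<^sup>2, \<dots>)\<close>.\<close>

definition diag_sq :: "real ^ 'd::finite \<Rightarrow> real ^ 'd ^ 'd" where
  "diag_sq \<sigma> = (\<chi> i j. if i = j then (vec_nth \<sigma> i)\<^sup>2 else 0)"

definition chi_square :: "nat \<Rightarrow> real measure" where
  "chi_square k = density lborel (\<lambda>x. ennreal (if x > 0
     then x powr (real k / 2 - 1) * exp (- x / 2) / (2 powr (real k / 2) * Gamma (real k / 2))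
     else 0))"

definition chi_square_quantile :: "nat \<Rightarrow> real \<Rightarrow> real" where
  "chi_square_quantile k \<alpha> = Inf {x. \<alpha> \<le> cdf (chi_square k) x}"

definition ellipsoid :: "real ^ 'd::finite \<Rightarrow> real ^ 'd \<Rightarrow> real \<Rightarrow> (real ^ 'd) set" where
  "ellipsoid \<mu> \<sigma> \<alpha> = {\<theta>. inner (\<theta> - \<mu>) (matrix_inv (diag_sq \<sigma>) *v (\<theta> - \<mu>))
                         \<le> chi_square_quantile CARD('d) \<alpha>}"

text \<open>
  The uniform distribution lives on the trace of Lebesgue measure on \<open>T\<close>, so the values of a
  random variable outside \<open>T\<close> play no role.
\<close>

definition Unif :: "(real ^ 'd::finite) set \<Rightarrow> (real ^ 'd) measure" where
  "Unif T = uniform_measure (lebesgue_on T) T"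

end

theory Submission
  imports Defs
begin

text \<open>
  For a \<open>C\<^sup>3\<close> function \<open>F\<close> on \<open>\<real>\<^sup>d\<close>, \<open>d = 2p\<close>, write \<open>\<partial>\<^sub>jF(\<theta>) = \<partial>\<^sub>jF(\<mu>) + L(\<theta>) + R(\<theta>)\<close>, where
  \<open>L(\<theta>) = h \<bullet> (\<theta> - \<mu>)\<close> for the \<open>j\<close>-th column \<open>h\<close> of the Hessian at \<open>\<mu>\<close>. As \<open>L\<close> has mean zero, the
  variance is at least \<open>E[L\<^sup>2] + 2 E[L R]\<close>. The ellipsoid is an affine image of the unit ball, whose
  second moments are at least \<open>1 / (d + 2)\<close>, so \<open>E[L\<^sup>2] \<ge> \<parallel>h\<parallel>\<^sup>2 \<sigma>\<^sub>m\<^sub>i\<^sub>n\<^sup>2 \<chi>\<^sup>2 / (d + 2)\<close>; and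
  \<open>\<parallel>h\<parallel> \<ge> -h\<^sub>j \<ge> \<kappa>\<close> because the smallest eigenvalue of a symmetric matrix bounds its quadratic form
  from below. The cross term is at most a constant times \<open>\<Lambda> M\<^sub>3 \<sigma>\<^sub>m\<^sub>a\<^sub>x\<^sup>3\<close> by \<open>\<parallel>h\<parallel> \<le> \<Lambda>\<close> and Taylor's theorem.
\<close>

no_notation vec_index (infixl "$" 100)
no_notation scalar_prod (infix "\<bullet>" 70)

subsection \<open>The smallest eigenvalue of a symmetric matrix\<close>

lemma symmetric_matrix_inner:
  fixes A :: "real ^ 'd ^ 'd::finite"
  assumes "\<And>i j. A $ i $ j = A $ j $ i"
  shows "x \<bullet> (A *v y) = (A *v x) \<bullet> y"
proof -
  have "Finite_Cartesian_Product.transpose A = A"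
    using assms by (simp add: Finite_Cartesian_Product.transpose_def vec_eq_iff)
  then show ?thesis
    by (metis dot_lmul_matrix transpose_matrix_vector)
qed

text \<open>By symmetry, eigenvectors to distinct eigenvalues are orthogonal, so choosing one per
  eigenvalue gives an independent set, which is finite. Finiteness is what makes the
  \<open>Min\<close> in \<open>lambda_min\<close> meaningful.\<close>

lemma finite_eigenvalues_symmetric:
  fixes A :: "real ^ 'd ^ 'd::finite"
  assumes sym: "\<And>i j. A $ i $ j = A $ j $ i"
  shows "finite {l. \<exists>v. v \<noteq> 0 \<and> A *v v = l *\<^sub>R v}"
proof -
  define S where "S = {l. \<exists>v. v \<noteq> 0 \<and> A *v v = l *\<^sub>R v}"
  have "\<forall>l\<in>S. \<exists>v. v \<noteq> 0 \<and> A *v v = l *\<^sub>R v" by (simp add: S_def)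
  from bchoice[OF this]
  obtain w where w: "\<And>l. l \<in> S \<Longrightarrow> w l \<noteq> 0" "\<And>l. l \<in> S \<Longrightarrow> A *v w l = l *\<^sub>R w l"
    by blast
  have orth: "w l \<bullet> w m = 0" if lm: "l \<in> S" "m \<in> S" "l \<noteq> m" for l m
  proof -
    have "m * (w l \<bullet> w m) = l * (w l \<bullet> w m)"
      using symmetric_matrix_inner[OF sym, of "w l" "w m"] w(2)[OF lm(1)] w(2)[OF lm(2)]
      by (simp only: inner_scaleR_left inner_scaleR_right)
    then show ?thesis using lm(3) by simp
  qed
  have "pairwise real_inner_class.orthogonal (w ` S)"
    using orth by (force simp: pairwise_def real_inner_class.orthogonal_def)
  moreover have "0 \<notin> w ` S"
    using w(1) by force
  ultimately have "finite (w ` S)"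
    by (intro independent_imp_finite pairwise_orthogonal_independent)
  moreover have "inj_on w S"
  proof (rule inj_onI, rule ccontr)
    fix l m assume lm: "l \<in> S" "m \<in> S" "w l = w m" "l \<noteq> m"
    then show False using orth[OF lm(1,2,4)] w(1)[OF lm(1)] by simp
  qed
  ultimately have "finite S" by (rule finite_imageD)
  then show ?thesis by (simp only: S_def)
qed

text \<open>The minimum \<open>m\<close> of the quadratic form on the unit sphere is attained by
  compactness, and the minimiser \<open>u\<close> is an eigenvector for \<open>m\<close>. Hence
  \<open>m\<close> is one of the eigenvalues over which \<open>lambda_min\<close> takes the
  minimum.\<close>

lemma lambda_min_le_quadratic_form:
  fixes A :: "real ^ 'd ^ 'd::finite"
  assumes sym: "\<And>i j. A $ i $ j = A $ j $ i"
  shows "lambda_min A * (v \<bullet> v) \<le> v \<bullet> (A *v v)"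
proof -
  let ?S = "{l. \<exists>v. v \<noteq> 0 \<and> A *v v = l *\<^sub>R v}"
  have "continuous_on (sphere 0 1) (\<lambda>x. x \<bullet> (A *v x))"
    by (intro continuous_intros linear_continuous_on)
  moreover have "sphere (0::real^'d) 1 \<noteq> {}" by simp
  ultimately obtain u where u: "norm u = 1" and min: "\<And>x. norm x = 1 \<Longrightarrow> u \<bullet> (A *v u) \<le> x \<bullet> (A *v x)"
    using continuous_attains_inf[OF compact_sphere, of 0 1 "\<lambda>x. x \<bullet> (A *v x)"] by auto
  define m where "m = u \<bullet> (A *v u)"
  have nonneg: "m * (x \<bullet> x) \<le> x \<bullet> (A *v x)" for x
  proof (cases "x = 0")
    case False
    have "m \<le> (x /\<^sub>R norm x) \<bullet> (A *v (x /\<^sub>R norm x))"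
      unfolding m_def using False by (intro min) simp
    also have "\<dots> = (x \<bullet> (A *v x)) / (norm x)\<^sup>2"
      by (simp add: matrix_vector_mult_scaleR power2_eq_square divide_simps)
    finally show ?thesis
      using False by (simp add: power2_norm_eq_inner divide_simps)
  qed simp
  \<comment> \<open>\<open>b\<close> is the residual of the eigenvalue equation at \<open>u\<close>;
    the goal is \<open>a = 0\<close>, that is, \<open>b = 0\<close>.\<close>
  define b where "b = A *v u - m *\<^sub>R u"
  define a c where "a = b \<bullet> b" and "c = b \<bullet> (A *v b) - m * (b \<bullet> b)"
  have c: "c \<ge> 0" using nonneg[of b] by (simp add: c_def)
  have uu: "u \<bullet> u = 1" using u by (simp add: norm_eq_1)
  \<comment> \<open>The form \<open>x \<bullet> (A *v x) - m * (x \<bullet> x)\<close> is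
    nonnegative and vanishes at \<open>u\<close>. The left-hand side is its value at
    \<open>u + t *\<^sub>R b\<close>.\<close>
  have quad: "2 * t * a + t\<^sup>2 * c \<ge> 0" for t
  proof -
    have "b \<bullet> (A *v u) = u \<bullet> (A *v b)"
      using symmetric_matrix_inner[OF sym, of u b] by (simp add: inner_commute)
    moreover have "b \<bullet> (A *v u) - m * (b \<bullet> u) = a"
      unfolding a_def by (subst (4) b_def) (simp add: inner_diff_right)
    ultimately have "2 * t * a + t\<^sup>2 * c =
        (u + t *\<^sub>R b) \<bullet> (A *v (u + t *\<^sub>R b)) - m * ((u + t *\<^sub>R b) \<bullet> (u + t *\<^sub>R b))"
      using uu by (simp add: c_def m_def matrix_vector_mult_scaleR matrix_vector_right_distrib
          inner_add_left inner_add_right inner_commute[of b u] algebra_simps power2_eq_square)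
    then show ?thesis using nonneg by simp
  qed
  have "a = 0"
  proof (rule ccontr)
    assume "a \<noteq> 0"
    then have "a > 0" by (simp add: a_def)
    \<comment> \<open>For this negative \<open>t\<close> the linear term outweighs the quadratic
      one. The denominator \<open>c + 1\<close> also covers the case \<open>c = 0\<close>.\<close>
    define t where "t = - a / (c + 1)"
    have t: "t * (c + 1) = - a" using c by (simp add: t_def)
    have "(2 * t * a + t\<^sup>2 * c) * (c + 1)\<^sup>2 = 2 * a * (c + 1) * (t * (c + 1)) + c * (t * (c + 1))\<^sup>2"
      by (simp add: power2_eq_square algebra_simps)
    also have "\<dots> = - (a\<^sup>2 * (c + 2))"
      unfolding t by (simp add: power2_eq_square algebra_simps)
    also have "\<dots> < 0" using \<open>a > 0\<close> c by simp
    finally have "2 * t * a + t\<^sup>2 * c < 0"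
      by (simp add: mult_less_0_iff not_less[symmetric])
    then show False using quad[of t] by linarith
  qed
  then have "A *v u = m *\<^sub>R u" by (simp add: a_def b_def)
  moreover have "u \<noteq> 0" using u by auto
  ultimately have "m \<in> ?S" by blast
  then have "lambda_min A \<le> m"
    unfolding lambda_min_def using finite_eigenvalues_symmetric[OF sym] by (intro Min_le)
  then show ?thesis
    using nonneg[of v] by (smt (verit) inner_ge_zero mult_right_mono)
qed

subsection \<open>Symmetry of second derivatives and Taylor estimate\<close>

lemma partial_deriv_eq:
  assumes "(f has_derivative D) (at x)"
  shows "partial_deriv j f x = D (axis j 1)"
proof -
  have "((\<lambda>t. f (x + t *\<^sub>R axis j 1)) has_derivative (\<lambda>t. D (t *\<^sub>R axis j 1))) (at 0)"
  proof (rule has_derivative_compose[where f = "\<lambda>t. x + t *\<^sub>R axis j 1" and g = f, unfolded o_def])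
    show "((\<lambda>t. x + t *\<^sub>R axis j 1) has_derivative (\<lambda>t. t *\<^sub>R axis j 1)) (at 0)"
      by (auto intro!: derivative_eq_intros)
  qed (use assms in simp)
  moreover have "D (t *\<^sub>R axis j 1) = D (axis j 1) * t" for t
    using has_derivative_linear[OF assms] by (simp add: linear_cmul)
  ultimately show ?thesis
    unfolding partial_deriv_def has_field_derivative_def[symmetric]
    by (intro DERIV_imp_deriv) (simp add: has_field_derivative_def)
qed

lemma has_derivative_partial_deriv:
  fixes f :: "real ^ 'd::finite \<Rightarrow> real"
  assumes "f differentiable (at x)"
  shows "(f has_derivative (\<lambda>v. \<Sum>j\<in>UNIV. v $ j * partial_deriv j f x)) (at x)"
proof -
  from assms obtain D where D: "(f has_derivative D) (at x)"
    unfolding differentiable_def by blast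
  have lin: "linear D" using D by (rule has_derivative_linear)
  have "D v = (\<Sum>j\<in>UNIV. v $ j * partial_deriv j f x)" for v
  proof -
    have "D v = D (\<Sum>j\<in>UNIV. (v $ j) *\<^sub>R axis j 1)"
      using basis_expansion[of v] by (simp add: scalar_mult_eq_scaleR)
    also have "\<dots> = (\<Sum>j\<in>UNIV. v $ j * partial_deriv j f x)"
      by (simp add: linear_sum[OF lin] linear_cmul[OF lin] partial_deriv_eq[OF D])
    finally show ?thesis .
  qed
  then have "D = (\<lambda>v. \<Sum>j\<in>UNIV. v $ j * partial_deriv j f x)" by blast
  with D show ?thesis by simp
qed

text \<open>The chain rule along a line, which brings the one-variable mean value and Maclaurin
  theorems to bear on functions of several variables.\<close>

lemma line_deriv:
  fixes f :: "real ^ 'd::finite \<Rightarrow> real"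
  assumes "open U" "f differentiable_on U" "x + t *\<^sub>R v \<in> U"
  shows "((\<lambda>s. f (x + s *\<^sub>R v)) has_real_derivative
           (\<Sum>j\<in>UNIV. v $ j * partial_deriv j f (x + t *\<^sub>R v))) (at t)"
proof -
  have f: "f differentiable (at (x + t *\<^sub>R v))"
    using assms by (metis at_within_open differentiable_on_def)
  have "((\<lambda>s. f (x + s *\<^sub>R v)) has_derivative
      (\<lambda>s. \<Sum>j\<in>UNIV. (s *\<^sub>R v) $ j * partial_deriv j f (x + t *\<^sub>R v))) (at t)"
  proof (rule has_derivative_compose[where f = "\<lambda>s. x + s *\<^sub>R v" and g = f, unfolded o_def])
    show "((\<lambda>s. x + s *\<^sub>R v) has_derivative (\<lambda>s. s *\<^sub>R v)) (at t)"
      by (auto intro!: derivative_eq_intros)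
  qed (rule has_derivative_partial_deriv[OF f])
  moreover have "(\<lambda>s. \<Sum>j\<in>UNIV. (s *\<^sub>R v) $ j * partial_deriv j f (x + t *\<^sub>R v))
      = (*) (\<Sum>j\<in>UNIV. v $ j * partial_deriv j f (x + t *\<^sub>R v))"
    by (auto simp: fun_eq_iff sum_distrib_left sum_distrib_right mult_ac)
  ultimately show ?thesis
    by (simp add: has_field_derivative_def)
qed

lemma axis_line_deriv:
  fixes f :: "real ^ 'd::finite \<Rightarrow> real"
  assumes "open U" "f differentiable_on U" "x + t *\<^sub>R axis i 1 \<in> U"
  shows "((\<lambda>s. f (x + s *\<^sub>R axis i 1)) has_real_derivative
           partial_deriv i f (x + t *\<^sub>R axis i 1)) (at t)"
  using line_deriv[OF assms] by (simp add: axis_def if_distrib[of "\<lambda>a. a * _"] cong: if_cong)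

text \<open>The mean value theorem is applied twice: first in direction \<open>i\<close> to the
  increment \<open>\<phi>\<close> of \<open>f\<close> across a step \<open>s\<close> in direction
  \<open>j\<close>, then in direction \<open>j\<close> to \<open>partial_deriv i f\<close>. The
  radius \<open>2 * s\<close> comes from the triangle inequality for two steps of length at most
  \<open>s\<close>.\<close>

lemma second_difference_eq_partial_deriv:
  fixes f :: "real ^ 'd::finite \<Rightarrow> real"
  assumes "open U" "f differentiable_on U" "partial_deriv i f differentiable_on U"
    and U: "cball x (2 * s) \<subseteq> U" and s: "s > 0"
  obtains \<xi> where "\<xi> \<in> cball x (2 * s)"
    "f (x + s *\<^sub>R axis i 1 + s *\<^sub>R axis j 1) - f (x + s *\<^sub>R axis i 1) - f (x + s *\<^sub>R axis j 1) + f x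
       = s\<^sup>2 * partial_deriv j (partial_deriv i f) \<xi>"
proof -
  have mem: "x + a *\<^sub>R axis i 1 + b *\<^sub>R axis j 1 \<in> cball x (2 * s)"
    if "0 \<le> a" "a \<le> s" "0 \<le> b" "b \<le> s" for a b
  proof -
    have "norm (a *\<^sub>R axis i 1 + b *\<^sub>R axis j 1 :: real ^ 'd) \<le> norm (a *\<^sub>R axis i 1 :: real ^ 'd) + norm (b *\<^sub>R axis j 1 :: real ^ 'd)"
      by (rule norm_triangle_ineq)
    also have "\<dots> \<le> 2 * s" using that by simp
    finally have "norm (a *\<^sub>R axis i 1 + b *\<^sub>R axis j 1 :: real ^ 'd) \<le> 2 * s" .
    then show ?thesis
      unfolding mem_cball dist_norm by (metis add.assoc add_diff_cancel_left' norm_minus_commute)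
  qed
  have mem': "x + b *\<^sub>R axis j 1 + a *\<^sub>R axis i 1 \<in> U" if "0 \<le> a" "a \<le> s" "0 \<le> b" "b \<le> s" for a b
    using mem[OF that] U by (auto simp: add_ac)
  define \<phi> where "\<phi> = (\<lambda>a. f ((x + s *\<^sub>R axis j 1) + a *\<^sub>R axis i 1) - f (x + a *\<^sub>R axis i 1))"
  define \<phi>' where "\<phi>' = (\<lambda>a. partial_deriv i f ((x + s *\<^sub>R axis j 1) + a *\<^sub>R axis i 1) - partial_deriv i f (x + a *\<^sub>R axis i 1))"
  have "\<exists>a>0. a < s \<and> \<phi> s - \<phi> 0 = (s - 0) * \<phi>' a"
  proof (rule MVT2[OF s])
    fix a assume a: "0 \<le> a" "a \<le> s"
    show "(\<phi> has_real_derivative \<phi>' a) (at a)"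
      unfolding \<phi>_def \<phi>'_def using mem'[of a s] mem'[of a 0] a s
      by (intro DERIV_diff axis_line_deriv[OF assms(1,2)]) simp_all
  qed
  then obtain a where a: "0 < a" "a < s" "\<phi> s - \<phi> 0 = s * \<phi>' a" by auto
  let ?y = "x + a *\<^sub>R axis i 1"
  have "\<exists>b>0. b < s \<and> partial_deriv i f (?y + s *\<^sub>R axis j 1) - partial_deriv i f (?y + 0 *\<^sub>R axis j 1)
      = (s - 0) * partial_deriv j (partial_deriv i f) (?y + b *\<^sub>R axis j 1)"
  proof (rule MVT2[OF s])
    fix b assume b: "0 \<le> b" "b \<le> s"
    show "((\<lambda>b. partial_deriv i f (?y + b *\<^sub>R axis j 1)) has_real_derivative
        partial_deriv j (partial_deriv i f) (?y + b *\<^sub>R axis j 1)) (at b)"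
      using mem[of a b] a b U by (intro axis_line_deriv[OF assms(1,3)]) auto
  qed
  then obtain b where b: "0 < b" "b < s"
    "\<phi>' a = s * partial_deriv j (partial_deriv i f) (?y + b *\<^sub>R axis j 1)"
    by (auto simp: \<phi>'_def add_ac)
  show thesis
  proof (rule that)
    show "?y + b *\<^sub>R axis j 1 \<in> cball x (2 * s)" using a b by (intro mem) auto
    show "f (x + s *\<^sub>R axis i 1 + s *\<^sub>R axis j 1) - f (x + s *\<^sub>R axis i 1) - f (x + s *\<^sub>R axis j 1) + f x
       = s\<^sup>2 * partial_deriv j (partial_deriv i f) (?y + b *\<^sub>R axis j 1)"
      using a(3) b(3) by (simp add: \<phi>_def power2_eq_square add_ac)
  qed
qed

text \<open>Schwarz's theorem. The second difference is symmetric in \<open>i\<close> and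
  \<open>j\<close>, so both mixed derivatives take a common value at points arbitrarily close to
  \<open>x\<close>, and continuity forces them to agree at \<open>x\<close>.\<close>

lemma partial_deriv_commute:
  fixes f :: "real ^ 'd::finite \<Rightarrow> real"
  assumes U: "open U" "x \<in> U" and f: "f differentiable_on U" "\<And>j. partial_deriv j f differentiable_on U"
    and cont: "\<And>i j. continuous_on U (partial_deriv i (partial_deriv j f))"
  shows "partial_deriv i (partial_deriv j f) x = partial_deriv j (partial_deriv i f) x"
proof (rule ccontr)
  let ?P = "partial_deriv i (partial_deriv j f)" and ?Q = "partial_deriv j (partial_deriv i f)"
  assume ne: "?P x \<noteq> ?Q x"
  \<comment> \<open>Half the gap: two deviations below \<open>\<epsilon>\<close> from a common value
    cannot bridge it.\<close>
  define \<epsilon> where "\<epsilon> = dist (?P x) (?Q x) / 2"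
  have \<epsilon>: "\<epsilon> > 0" using ne by (simp add: \<epsilon>_def)
  have "\<forall>\<^sub>F y in nhds x. y \<in> U \<and> dist (?P y) (?P x) < \<epsilon> \<and> dist (?Q y) (?Q x) < \<epsilon>"
    using U cont \<epsilon>
    by (intro eventually_conj tendstoD[where l = "?P x"] tendstoD[where l = "?Q x"] eventually_nhds_in_open)
      (auto simp: continuous_on_eq_continuous_at isCont_def tendsto_at_iff_tendsto_nhds)
  then obtain d where d: "d > 0"
    "\<And>y. dist y x < d \<Longrightarrow> y \<in> U \<and> dist (?P y) (?P x) < \<epsilon> \<and> dist (?Q y) (?Q x) < \<epsilon>"
    by (auto simp: eventually_nhds_metric)
  \<comment> \<open>The closed ball of radius \<open>2 * s = d / 2\<close> then lies inside the open
    ball of radius \<open>d\<close>.\<close>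
  define s where "s = d / 4"
  have s: "s > 0" "cball x (2 * s) \<subseteq> U" "\<And>y. y \<in> cball x (2 * s) \<Longrightarrow> dist y x < d"
    using d by (auto simp: s_def dist_commute)
  obtain \<xi> where \<xi>: "\<xi> \<in> cball x (2 * s)"
    "f (x + s *\<^sub>R axis i 1 + s *\<^sub>R axis j 1) - f (x + s *\<^sub>R axis i 1) - f (x + s *\<^sub>R axis j 1) + f x = s\<^sup>2 * ?Q \<xi>"
    using second_difference_eq_partial_deriv[OF U(1) f s(2,1)] by blast
  obtain \<eta> where \<eta>: "\<eta> \<in> cball x (2 * s)"
    "f (x + s *\<^sub>R axis j 1 + s *\<^sub>R axis i 1) - f (x + s *\<^sub>R axis j 1) - f (x + s *\<^sub>R axis i 1) + f x = s\<^sup>2 * ?P \<eta>"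
    using second_difference_eq_partial_deriv[OF U(1) f s(2,1)] by blast
  have swap: "x + s *\<^sub>R axis j 1 + s *\<^sub>R axis i 1 = x + s *\<^sub>R axis i 1 + s *\<^sub>R axis j 1"
    by (simp add: add_ac)
  have "s\<^sup>2 * ?Q \<xi> = s\<^sup>2 * ?P \<eta>"
    using \<xi>(2) \<eta>(2) unfolding swap by linarith
  then have "?Q \<xi> = ?P \<eta>" using s by simp
  moreover have "dist (?Q \<xi>) (?Q x) < \<epsilon>" "dist (?P \<eta>) (?P x) < \<epsilon>"
    using d(2) s(3) \<xi>(1) \<eta>(1) by blast+
  ultimately show False
    using dist_triangle3[of "?P x" "?Q x" "?P \<eta>"] by (simp add: \<epsilon>_def)
qed

text \<open>Maclaurin's formula of order two for \<open>g\<close> along the segment. The remainder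
  is a double sum bounded by \<open>M\<close> times the squared 1-norm of \<open>v\<close>; passing
  to the Euclidean norm costs the factor \<open>CARD('d)\<close>.\<close>

lemma first_order_taylor_bound:
  fixes g :: "real ^ 'd::finite \<Rightarrow> real"
  assumes "open U" "g differentiable_on U" "\<And>k. partial_deriv k g differentiable_on U"
    and seg: "\<And>t. 0 \<le> t \<Longrightarrow> t \<le> 1 \<Longrightarrow> x + t *\<^sub>R v \<in> U"
    and M: "\<And>y i k. y \<in> U \<Longrightarrow> \<bar>partial_deriv i (partial_deriv k g) y\<bar> \<le> M"
  shows "\<bar>g (x + v) - g x - (\<Sum>k\<in>UNIV. v $ k * partial_deriv k g x)\<bar> \<le> M * real CARD('d) * (norm v)\<^sup>2 / 2"
proof -
  \<comment> \<open>\<open>D 0\<close>, \<open>D 1\<close> and \<open>D 2\<close> are the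
    restriction of \<open>g\<close> to the line and its first two derivatives, in the form that
    \<open>Maclaurin2\<close> expects.\<close>
  define D where "D m t = (if m = 0 then g (x + t *\<^sub>R v)
      else if m = 1 then (\<Sum>k\<in>UNIV. v $ k * partial_deriv k g (x + t *\<^sub>R v))
      else (\<Sum>k\<in>UNIV. v $ k * (\<Sum>i\<in>UNIV. v $ i * partial_deriv i (partial_deriv k g) (x + t *\<^sub>R v))))"
    for m :: nat and t :: real
  have "\<exists>t. 0 < t \<and> t \<le> 1 \<and> g (x + 1 *\<^sub>R v) = (\<Sum>m<2. D m 0 / fact m * 1 ^ m) + D 2 t / fact 2 * 1 ^ 2"
  proof (rule Maclaurin2)
    show "\<forall>m t. m < 2 \<and> 0 \<le> t \<and> t \<le> 1 \<longrightarrow> (D m has_real_derivative D (Suc m) t) (at t)"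
    proof (intro allI impI)
      fix m :: nat and t :: real assume *: "m < 2 \<and> 0 \<le> t \<and> t \<le> 1"
      then consider "m = 0" | "m = 1" by linarith
      then show "(D m has_real_derivative D (Suc m) t) (at t)"
      proof cases
        case 1
        then show ?thesis
          using line_deriv[OF assms(1,2) seg, of t] * by (simp add: D_def[abs_def])
      next
        case 2
        have "((\<lambda>t. \<Sum>k\<in>UNIV. v $ k * partial_deriv k g (x + t *\<^sub>R v)) has_real_derivative D 2 t) (at t)"
          unfolding D_def using *
          by (auto intro!: DERIV_sum DERIV_cmult line_deriv[OF assms(1,3) seg])
        then show ?thesis
          using 2 by (simp add: D_def[abs_def] numeral_2_eq_2)
      qed
    qed
  qed (auto simp: D_def)
  then obtain t where t: "0 < t" "t \<le> 1"
    "g (x + v) = g x + (\<Sum>k\<in>UNIV. v $ k * partial_deriv k g x) + D 2 t / 2"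
    by (auto simp: D_def numeral_2_eq_2)
  have "\<bar>D 2 t\<bar> \<le> (\<Sum>k\<in>UNIV. \<Sum>i\<in>UNIV. \<bar>v $ k\<bar> * (\<bar>v $ i\<bar> * M))"
    unfolding D_def using seg[of t] t M
    by (auto simp: sum_distrib_left abs_mult intro!: order_trans[OF sum_abs] sum_mono mult_left_mono)
  also have "\<dots> = M * (\<Sum>k\<in>UNIV. \<bar>v $ k\<bar>)\<^sup>2"
    by (simp add: power2_eq_square sum_product sum_distrib_left mult_ac)
  also have "\<dots> \<le> M * (real CARD('d) * (\<Sum>k\<in>UNIV. (v $ k)\<^sup>2))"
  proof (rule mult_left_mono)
    show "(\<Sum>k\<in>UNIV. \<bar>v $ k\<bar>)\<^sup>2 \<le> real CARD('d) * (\<Sum>k\<in>UNIV. (v $ k)\<^sup>2)"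
      using sum_squared_le_sum_of_squares[of "\<lambda>k. \<bar>v $ k\<bar>" UNIV] by (simp add: mult_ac)
    \<comment> \<open>The sign of \<open>M\<close> follows from the bound at \<open>x\<close>
      itself, for an arbitrary pair of indices.\<close>
    have "\<bar>partial_deriv undefined (partial_deriv undefined g) x\<bar> \<le> M"
      using M[of x] seg[of 0] by simp
    then show "0 \<le> M" by linarith
  qed
  also have "\<dots> = M * real CARD('d) * (norm v)\<^sup>2"
    by (simp only: power2_norm_eq_inner) (simp add: inner_vec_def power2_eq_square)
  finally show ?thesis using t(3) by simp
qed

subsection \<open>Moments of the unit ball\<close>

lemma prod_Basis_cart:
  fixes F :: "real ^ 'd::finite \<Rightarrow> 'a::comm_monoid_mult"
  shows "prod F Basis = (\<Prod>j\<in>UNIV. F (axis j 1))"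
proof -
  have Basis: "(Basis :: (real ^ 'd) set) = (\<lambda>j. axis j 1) ` UNIV"
    by (auto simp: Basis_vec_def)
  have "inj (\<lambda>j::'d. axis j (1::real))"
    by (auto simp: inj_def axis_eq_axis)
  then show ?thesis
    unfolding Basis by (subst prod.reindex) simp_all
qed

text \<open>Change of variables for a diagonal affine map, with its Jacobian in front. It serves for
  coordinate reflections, for dilations, and for the map from the unit ball onto the
  ellipsoid.\<close>

lemma lborel_integral_affine_cart:
  fixes f :: "real ^ 'd::finite \<Rightarrow> real" and c t :: "real ^ 'd"
  assumes c: "\<And>j. c $ j \<noteq> 0" and f[measurable]: "f \<in> borel_measurable borel"
  shows "integral\<^sup>L lborel f = (\<Prod>j\<in>UNIV. \<bar>c $ j\<bar>) * (\<integral>x. f (t + (\<chi> j. c $ j * x $ j)) \<partial>lborel)"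
proof -
  let ?T = "\<lambda>x. t + (\<Sum>b\<in>Basis. (c \<bullet> b * (x \<bullet> b)) *\<^sub>R b)"
  have T: "?T x = t + (\<chi> j. c $ j * x $ j)" for x
  proof -
    let ?y = "\<chi> j. c $ j * x $ j"
    have "(\<Sum>b\<in>Basis. (c \<bullet> b * (x \<bullet> b)) *\<^sub>R b) = (\<Sum>b\<in>Basis. (?y \<bullet> b) *\<^sub>R b)"
      by (intro sum.cong refl) (auto simp: Basis_vec_def inner_axis)
    then show ?thesis by (simp only: euclidean_representation)
  qed
  have [measurable]: "?T \<in> borel \<rightarrow>\<^sub>M borel"
    by (intro borel_measurable_continuous_onI continuous_intros)
  have "lborel = density (distr lborel borel ?T) (\<lambda>_. ennreal (\<Prod>b\<in>Basis. \<bar>c \<bullet> b\<bar>))"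
    using c by (intro lborel_affine_euclidean) (auto simp: Basis_vec_def inner_axis)
  then have "integral\<^sup>L lborel f = (\<integral>x. f x \<partial>density (distr lborel borel ?T) (\<lambda>_. ennreal (\<Prod>b\<in>Basis. \<bar>c \<bullet> b\<bar>)))"
    by (rule arg_cong)
  also have "\<dots> = (\<Prod>b\<in>Basis. \<bar>c \<bullet> b\<bar>) * (\<integral>x. f (?T x) \<partial>lborel)"
    by (subst integral_density) (auto simp: integral_distr intro!: prod_nonneg)
  finally show ?thesis
    unfolding T by (simp add: prod_Basis_cart inner_axis)
qed

text \<open>An involutive permutation of coordinates maps boxes to boxes with the same side lengths
  up to order, and Lebesgue measure is determined by its values on boxes.\<close>

lemma lborel_integral_permute_cart:
  fixes f :: "real ^ 'd::finite \<Rightarrow> real"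
  assumes \<pi>: "\<And>k. \<pi> (\<pi> k) = k" and f[measurable]: "f \<in> borel_measurable borel"
  shows "integral\<^sup>L lborel f = (\<integral>x. f (\<chi> k. x $ \<pi> k) \<partial>lborel)"
proof -
  let ?P = "\<lambda>x :: real ^ 'd. (\<chi> k. x $ \<pi> k)"
  have [measurable]: "?P \<in> borel \<rightarrow>\<^sub>M borel"
    by (intro borel_measurable_continuous_onI continuous_intros)
  have bij: "bij \<pi>" using \<pi> by (metis bijI')
  have "lborel = distr lborel borel ?P"
  proof (rule lborel_eqI)
    fix l u :: "real ^ 'd" assume le: "\<And>b. b \<in> Basis \<Longrightarrow> l \<bullet> b \<le> u \<bullet> b"
    have le': "l $ k \<le> u $ k" for k
      using le[of "axis k 1"] by (simp add: inner_axis axis_in_Basis_iff)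
    have "?P -` box l u = box (?P l) (?P u)"
      using \<pi> by (auto simp: mem_box_cart) (metis \<pi>)+
    then have "emeasure (distr lborel borel ?P) (box l u) = emeasure lborel (box (?P l) (?P u))"
      by (simp add: emeasure_distr)
    also have "\<dots> = ennreal (\<Prod>b\<in>Basis. (?P u - ?P l) \<bullet> b)"
      using le' by (intro emeasure_lborel_box) (auto simp: Basis_vec_def inner_axis)
    also have "(\<Prod>b\<in>Basis. (?P u - ?P l) \<bullet> b) = (\<Prod>k\<in>UNIV. (u - l) $ \<pi> k)"
      by (simp add: prod_Basis_cart inner_axis)
    also have "\<dots> = (\<Prod>k\<in>UNIV. (u - l) $ k)"
      using prod.reindex_bij_betw[OF bij, of "\<lambda>k. (u - l) $ k"] by simp
    also have "\<dots> = (\<Prod>b\<in>Basis. (u - l) \<bullet> b)"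
      by (simp add: prod_Basis_cart inner_axis)
    finally show "emeasure (distr lborel borel ?P) (box l u) = (\<Prod>b\<in>Basis. (u - l) \<bullet> b)" .
  qed simp
  then have "integral\<^sup>L lborel f = integral\<^sup>L (distr lborel borel ?P) f"
    by (rule arg_cong)
  then show ?thesis by (simp add: integral_distr)
qed

section \<open>Symmetry and scaling of moments over the unit ball\<close>

lemmas borel_measurable_ball_moment_intros =
  borel_measurable_times borel_measurable_indicator borel_closed closed_cball
  borel_measurable_continuous_onI continuous_intros

text \<open>The left-hand side has the shape that \<open>lborel_integral_affine_cart\<close>
  produces for zero translation and the sign vector that flips coordinate \<open>k\<close>.\<close>

lemma norm_reflect_coordinate:
  "norm (0 + (\<chi> j. (\<chi> j. if j = k then -1 else (1 :: real)) $ j * x $ j) :: real ^ 'd::finite) = norm x"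
proof -
  have "((if j = k then -1 else 1) * x $ j)\<^sup>2 = (x $ j)\<^sup>2" for j by simp
  then show ?thesis by (simp add: norm_vec_def L2_set_def)
qed

text \<open>Reflecting coordinate \<open>k\<close> preserves the ball and negates the integrand, so
  the integral equals its own negative.\<close>

lemma unit_ball_first_moment:
  "(\<integral>x. indicat_real (cball 0 1) x * x $ k \<partial>(lborel :: (real ^ 'd::finite) measure)) = 0"
proof -
  let ?c = "\<chi> j. if j = k then -1 else (1 :: real)"
  let ?R = "\<lambda>x :: real ^ 'd. 0 + (\<chi> j. ?c $ j * x $ j)"
  have "(\<integral>x. indicat_real (cball 0 1) x * x $ k \<partial>(lborel :: (real ^ 'd) measure))
      = (\<Prod>j\<in>UNIV. \<bar>?c $ j\<bar>) * (\<integral>x. indicat_real (cball 0 1) (?R x) * ?R x $ k \<partial>lborel)"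
    by (intro lborel_integral_affine_cart borel_measurable_ball_moment_intros) auto
  also have "(\<Prod>j\<in>UNIV. \<bar>?c $ j\<bar>) = 1" by (intro prod.neutral) auto
  also have "(\<lambda>x. indicat_real (cball 0 1) (?R x) * ?R x $ k) = (\<lambda>x. - (indicat_real (cball 0 1) x * x $ k))"
    by (simp only: indicator_def mem_cball_0 norm_reflect_coordinate) (auto simp: fun_eq_iff)
  finally show ?thesis by simp
qed

text \<open>The same reflection works: it flips coordinate \<open>k\<close> and leaves
  \<open>l\<close> alone.\<close>

lemma unit_ball_mixed_moment:
  assumes "k \<noteq> l"
  shows "(\<integral>x. indicat_real (cball 0 1) x * (x $ k * x $ l) \<partial>(lborel :: (real ^ 'd::finite) measure)) = 0"
proof -
  let ?c = "\<chi> j. if j = k then -1 else (1 :: real)"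
  let ?R = "\<lambda>x :: real ^ 'd. 0 + (\<chi> j. ?c $ j * x $ j)"
  have "(\<integral>x. indicat_real (cball 0 1) x * (x $ k * x $ l) \<partial>(lborel :: (real ^ 'd) measure))
      = (\<Prod>j\<in>UNIV. \<bar>?c $ j\<bar>) * (\<integral>x. indicat_real (cball 0 1) (?R x) * (?R x $ k * ?R x $ l) \<partial>lborel)"
    by (intro lborel_integral_affine_cart borel_measurable_ball_moment_intros) auto
  also have "(\<Prod>j\<in>UNIV. \<bar>?c $ j\<bar>) = 1" by (intro prod.neutral) auto
  also have "(\<lambda>x. indicat_real (cball 0 1) (?R x) * (?R x $ k * ?R x $ l))
      = (\<lambda>x. - (indicat_real (cball 0 1) x * (x $ k * x $ l)))"
    using assms by (simp only: indicator_def mem_cball_0 norm_reflect_coordinate) (auto simp: fun_eq_iff)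
  finally show ?thesis by simp
qed

lemma unit_ball_second_moment_swap:
  "(\<integral>x. indicat_real (cball 0 1) x * (x $ k)\<^sup>2 \<partial>(lborel :: (real ^ 'd::finite) measure)) =
   (\<integral>x. indicat_real (cball 0 1) x * (x $ l)\<^sup>2 \<partial>(lborel :: (real ^ 'd::finite) measure))"
proof -
  let ?\<pi> = "id(k := l, l := k)"
  let ?P = "\<lambda>x :: real ^ 'd. (\<chi> m. x $ ?\<pi> m)"
  have \<pi>: "?\<pi> (?\<pi> m) = m" for m by auto
  then have bij: "bij ?\<pi>" by (metis bijI')
  have n: "norm (?P x) = norm x" for x
    using sum.reindex_bij_betw[OF bij, of "\<lambda>m. (x $ m)\<^sup>2"] by (simp add: norm_vec_def L2_set_def)
  have "(\<integral>x. indicat_real (cball 0 1) x * (x $ k)\<^sup>2 \<partial>(lborel :: (real ^ 'd::finite) measure)) =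
      (\<integral>x. indicat_real (cball 0 1) (?P x) * (?P x $ k)\<^sup>2 \<partial>lborel)"
    by (intro lborel_integral_permute_cart[OF \<pi>] borel_measurable_ball_moment_intros)
  also have "(\<lambda>x. indicat_real (cball 0 1) (?P x) * (?P x $ k)\<^sup>2) = (\<lambda>x. indicat_real (cball 0 1) x * (x $ l)\<^sup>2)"
    using n by (auto simp: indicator_def)
  finally show ?thesis .
qed

text \<open>In the exponent, \<open>CARD('d)\<close> comes from the Jacobian of the dilation and
  \<open>m\<close> from the homogeneity of the integrand.\<close>

lemma unit_ball_moment_scale:
  fixes r :: real
  assumes r: "r > 0"
  shows "(\<integral>x. indicat_real (cball 0 r) x * norm x ^ m \<partial>(lborel :: (real ^ 'd::finite) measure)) =
    r ^ (CARD('d) + m) * (\<integral>x. indicat_real (cball 0 1) x * norm x ^ m \<partial>(lborel :: (real ^ 'd) measure))"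
proof -
  let ?S = "\<lambda>x :: real ^ 'd. 0 + (\<chi> j. (\<chi> j. r) $ j * x $ j)"
  have S: "?S x = r *\<^sub>R x" for x by (simp add: vec_eq_iff)
  have "(\<integral>x. indicat_real (cball 0 r) x * norm x ^ m \<partial>(lborel :: (real ^ 'd) measure)) =
      (\<Prod>j\<in>UNIV. \<bar>(\<chi> j. r) $ (j::'d)\<bar>) * (\<integral>x. indicat_real (cball 0 r) (?S x) * norm (?S x) ^ m \<partial>lborel)"
    using r by (intro lborel_integral_affine_cart borel_measurable_ball_moment_intros) simp
  also have "(\<Prod>j\<in>UNIV. \<bar>(\<chi> j. r) $ (j::'d)\<bar>) = r ^ CARD('d)" using r by simp
  also have "(\<lambda>x. indicat_real (cball 0 r) (?S x) * norm (?S x) ^ m) =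
      (\<lambda>x. r ^ m * (indicat_real (cball 0 1) x * norm x ^ m))"
    unfolding S using r by (auto simp: indicator_def power_mult_distrib)
  finally show ?thesis by (simp add: power_add)
qed

text \<open>
  The squared norm is at least \<open>r\<^sup>2\<close> on the shell between radius \<open>r\<close> and 1; letting \<open>r\<close> tend to 1
  in the resulting inequality avoids polar coordinates.
\<close>

lemma unit_ball_norm_moment_ge:
  "(\<integral>x. indicat_real (cball 0 1) x * (norm x)\<^sup>2 \<partial>(lborel :: (real ^ 'd::finite) measure)) * (real CARD('d) + 2)
    \<ge> measure lborel (cball (0 :: real ^ 'd) 1) * real CARD('d)"
proof -
  let ?L = "lborel :: (real ^ 'd) measure"
  define I where "I = (\<integral>x. indicat_real (cball 0 1) x * (norm x)\<^sup>2 \<partial>?L)"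
  define V where "V = measure ?L (cball 0 1)"
  let ?d = "CARD('d)"
  have int: "integrable ?L (\<lambda>x. indicat_real (cball 0 r) x * norm x ^ m)" for r m
    using borel_integrable_compact[OF compact_cball, of 0 r "\<lambda>x :: real ^ 'd. norm x ^ m"]
    by (simp add: continuous_intros)
  have ineq: "V * r\<^sup>2 * (\<Sum>i<?d. r ^ i) \<le> I * (\<Sum>i<?d+2. r ^ i)" if r: "0 < r" "r < 1" for r :: real
  proof -
    \<comment> \<open>The power 0 is kept so that the volume and the second moment of the shell are
      both instances of \<open>unit_ball_moment_scale\<close>.\<close>
    have "(\<integral>x. r\<^sup>2 * (indicat_real (cball 0 1) x * norm x ^ 0 - indicat_real (cball 0 r) x * norm x ^ 0) \<partial>?L)
        \<le> (\<integral>x. indicat_real (cball 0 1) x * norm x ^ 2 - indicat_real (cball 0 r) x * norm x ^ 2 \<partial>?L)"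
    proof (rule integral_mono)
      show "r\<^sup>2 * (indicat_real (cball 0 1) x * norm x ^ 0 - indicat_real (cball 0 r) x * norm x ^ 0)
          \<le> indicat_real (cball 0 1) x * norm x ^ 2 - indicat_real (cball 0 r) x * norm x ^ 2" for x :: "real ^ 'd"
        using r by (auto simp: indicator_def intro: power_mono)
    qed (intro integrable_mult_right Bochner_Integration.integrable_diff int)+
    moreover have "(\<integral>x. indicat_real (cball 0 1) x * norm x ^ m - indicat_real (cball 0 r) x * norm x ^ m \<partial>?L)
        = (1 - r ^ (?d + m)) * (\<integral>x. indicat_real (cball 0 1) x * norm x ^ m \<partial>?L)" for m
      by (simp only: Bochner_Integration.integral_diff[OF int int] unit_ball_moment_scale[OF r(1)] left_diff_distrib mult_1)
    ultimately have "r\<^sup>2 * ((1 - r ^ (?d + 0)) * (\<integral>x. indicat_real (cball 0 1) x * norm x ^ 0 \<partial>?L)) \<le> (1 - r ^ (?d + 2)) * I"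
      unfolding I_def by (simp only: integral_mult_right_zero)
    then have "r\<^sup>2 * ((1 - r ^ ?d) * V) \<le> (1 - r ^ (?d + 2)) * I"
      by (simp add: V_def)
    \<comment> \<open>Dividing by \<open>1 - r\<close> leaves geometric sums, which tend to the
      dimension and the dimension plus 2 as \<open>r\<close> tends to 1.\<close>
    then have "(1 - r) * (V * r\<^sup>2 * (\<Sum>i<?d. r ^ i)) \<le> (1 - r) * (I * (\<Sum>i<?d+2. r ^ i))"
      by (simp only: one_diff_power_eq mult_ac)
    then show ?thesis using r by simp
  qed
  have "V * 1\<^sup>2 * (\<Sum>i<?d. 1 ^ i) \<le> I * (\<Sum>i<?d+2. 1 ^ i)"
  proof (rule tendsto_le[where F = "at_left (1::real)"])
    show "((\<lambda>r. I * (\<Sum>i<?d+2. r ^ i)) \<longlongrightarrow> I * (\<Sum>i<?d+2. 1 ^ i)) (at_left 1)"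
      "((\<lambda>r. V * r\<^sup>2 * (\<Sum>i<?d. r ^ i)) \<longlongrightarrow> V * 1\<^sup>2 * (\<Sum>i<?d. 1 ^ i)) (at_left 1)"
      by (intro tendsto_intros)+
    show "\<forall>\<^sub>F r in at_left 1. V * r\<^sup>2 * (\<Sum>i<?d. r ^ i) \<le> I * (\<Sum>i<?d+2. r ^ i)"
      using ineq by (auto simp: eventually_at_left[of 0] intro!: exI[of _ 0])
  qed simp
  then show ?thesis by (simp add: I_def V_def add.commute)
qed

text \<open>The second moments of all coordinates agree and add up to the moment of the squared
  norm, so each is that moment divided by the dimension.\<close>

lemma unit_ball_second_moment_ge:
  "(\<integral>x. indicat_real (cball 0 1) x * (x $ k)\<^sup>2 \<partial>(lborel :: (real ^ 'd::finite) measure))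
    \<ge> measure lborel (cball (0 :: real ^ 'd) 1) / (real CARD('d) + 2)"
proof -
  let ?L = "lborel :: (real ^ 'd) measure"
  define I where "I = (\<integral>x. indicat_real (cball 0 1) x * (norm x)\<^sup>2 \<partial>?L)"
  define J where "J = (\<integral>x. indicat_real (cball 0 1) x * (x $ k)\<^sup>2 \<partial>?L)"
  have int: "integrable ?L (\<lambda>x. indicat_real (cball 0 1) x * (x $ l)\<^sup>2)" for l
    using borel_integrable_compact[OF compact_cball, of 0 1 "\<lambda>x :: real ^ 'd. (x $ l)\<^sup>2"]
    by (simp add: continuous_intros)
  have "I = (\<integral>x. (\<Sum>l\<in>UNIV. indicat_real (cball 0 1) x * (x $ l)\<^sup>2) \<partial>?L)"
    by (simp add: I_def norm_vec_def L2_set_def sum_nonneg sum_distrib_left)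
  also have "\<dots> = (\<Sum>l\<in>UNIV. \<integral>x. indicat_real (cball 0 1) x * (x $ l)\<^sup>2 \<partial>?L)"
    using int by (intro Bochner_Integration.integral_sum)
  also have "\<dots> = (\<Sum>l\<in>(UNIV :: 'd set). J)"
    unfolding J_def by (intro sum.cong refl unit_ball_second_moment_swap)
  finally have "I = real CARD('d) * J" by simp
  with unit_ball_norm_moment_ge[where 'd = 'd]
  have "measure ?L (cball 0 1) * real CARD('d) \<le> (real CARD('d) * J) * (real CARD('d) + 2)"
    by (simp add: I_def)
  then have "real CARD('d) * measure ?L (cball 0 1) \<le> real CARD('d) * (J * (real CARD('d) + 2))"
    by (simp add: mult_ac)
  then have "measure ?L (cball 0 1) \<le> J * (real CARD('d) + 2)"
    by simp
  then show ?thesis unfolding J_def[symmetric] by (simp add: divide_simps mult_ac)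
qed

subsection \<open>Chi-square quantiles\<close>

lemma sets_chi_square [simp]: "sets (chi_square k) = sets borel"
  and space_chi_square [simp]: "space (chi_square k) = UNIV"
  by (simp_all add: chi_square_def)

text \<open>The substitution of \<open>2 * x\<close> for \<open>x\<close> turns the density into the
  normalised integrand of \<open>Gamma (k / 2)\<close>.\<close>

lemma prob_space_chi_square:
  assumes "k > 0"
  shows "prob_space (chi_square k)"
proof
  let ?a = "real k / 2"
  let ?g = "\<lambda>x. indicator {0..} x * (x powr (?a - 1) / exp x)"
  have a: "?a > 0" using assms by simp
  have "emeasure (chi_square k) (space (chi_square k)) = (\<integral>\<^sup>+x. ennreal (if x > 0
      then x powr (?a - 1) * exp (- x / 2) / (2 powr ?a * Gamma ?a) else 0) \<partial>lborel)"
    by (simp add: chi_square_def emeasure_density)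
  also have "\<dots> = ennreal \<bar>2\<bar> * (\<integral>\<^sup>+x. ennreal (if 0 + 2 * x > 0
      then (0 + 2 * x) powr (?a - 1) * exp (- (0 + 2 * x) / 2) / (2 powr ?a * Gamma ?a) else 0) \<partial>lborel)"
    by (rule nn_integral_real_affine) auto
  also have "(\<lambda>x. ennreal (if 0 + 2 * x > 0
      then (0 + 2 * x) powr (?a - 1) * exp (- (0 + 2 * x) / 2) / (2 powr ?a * Gamma ?a) else 0))
      = (\<lambda>x. ennreal (1 / (2 * Gamma ?a)) * ennreal (?g x))"
  proof
    fix x :: real
    have "(2 * x) powr (?a - 1) * exp (- x) / (2 powr ?a * Gamma ?a) = 1 / (2 * Gamma ?a) * (x powr (?a - 1) / exp x)"
      if "x > 0"
    proof -
      have "2 powr ?a = 2 * 2 powr (?a - 1)" by (simp add: powr_diff)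
      moreover have "(2 * x) powr (?a - 1) = 2 powr (?a - 1) * x powr (?a - 1)"
        using that by (simp add: powr_mult)
      ultimately show ?thesis
        by (simp only: exp_minus) (simp add: divide_simps)
    qed
    then show "ennreal (if 0 + 2 * x > 0
      then (0 + 2 * x) powr (?a - 1) * exp (- (0 + 2 * x) / 2) / (2 powr ?a * Gamma ?a) else 0)
      = ennreal (1 / (2 * Gamma ?a)) * ennreal (?g x)"
      using Gamma_real_pos[OF a] by (cases "x > 0") (auto simp: ennreal_mult[symmetric] indicator_def)
  qed
  also have "(\<integral>\<^sup>+x. ennreal (1 / (2 * Gamma ?a)) * ennreal (?g x) \<partial>lborel) = ennreal (1 / (2 * Gamma ?a)) * (\<integral>\<^sup>+x. ennreal (?g x) \<partial>lborel)"
    by (rule nn_integral_cmult) auto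
  also have "(\<integral>\<^sup>+x. ennreal (?g x) \<partial>lborel) = ennreal (Gamma ?a)"
    by (rule nn_integral_has_integral_lebesgue[OF _ Gamma_integral_real[OF a]]) auto
  also have "ennreal \<bar>2\<bar> * (ennreal (1 / (2 * Gamma ?a)) * ennreal (Gamma ?a)) = 1"
  proof -
    have "ennreal x * (ennreal y * ennreal z) = ennreal (x * (y * z))" if "x \<ge> 0" "y \<ge> 0" for x y z :: real
      using that by (simp add: ennreal_mult')
    from this[of "\<bar>2\<bar>" "1 / (2 * Gamma ?a)" "Gamma ?a"] show ?thesis
      using Gamma_real_pos[OF a] by simp
  qed
  finally show "emeasure (chi_square k) (space (chi_square k)) = 1" .
qed

text \<open>The distribution function is 0 at 0 and right-continuous, so it stays below
  \<open>\<alpha>\<close> up to some \<open>e > 0\<close>. Positivity keeps the ellipsoid from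
  degenerating to a point.\<close>

lemma chi_square_quantile_pos:
  assumes k: "k > 0" and \<alpha>: "0 < \<alpha>" "\<alpha> < 1"
  shows "chi_square_quantile k \<alpha> > 0"
proof -
  interpret prob_space "chi_square k" using k by (rule prob_space_chi_square)
  interpret real_distribution "chi_square k" by unfold_locales simp
  let ?F = "cdf (chi_square k)"
  have "emeasure (chi_square k) {..0} = 0"
    unfolding chi_square_def by (subst emeasure_density) (auto simp: nn_integral_0_iff_AE)
  then have "?F 0 = 0" by (simp add: cdf_def measure_def)
  moreover have "(?F \<longlongrightarrow> ?F 0) (at_right 0)"
    using cdf_is_right_cont[of 0] by (simp add: continuous_within)
  ultimately have "\<forall>\<^sub>F x in at_right 0. ?F x < \<alpha>"
    using \<alpha> by (intro order_tendstoD(2)[of _ 0]) auto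
  then obtain e where e: "e > 0" "\<And>x. 0 < x \<Longrightarrow> x < e \<Longrightarrow> ?F x < \<alpha>"
    unfolding eventually_at_right_field by blast
  have "e \<le> x" if "\<alpha> \<le> ?F x" for x
  proof (rule ccontr)
    assume "\<not> e \<le> x"
    then have "?F x \<le> ?F (e / 2) \<or> ?F x < \<alpha>"
      using e cdf_nondecreasing[of x "e / 2"] by (cases "x > 0") auto
    then show False using that e(2)[of "e / 2"] e(1) by linarith
  qed
  \<comment> \<open>The set under \<open>Inf\<close> is nonempty since the distribution function
    tends to 1; here \<open>\<alpha> < 1\<close> enters.\<close>
  moreover have "\<exists>x. \<alpha> \<le> ?F x"
    using order_tendstoD(1)[OF cdf_lim_at_top_prob \<alpha>(2)]
    by (metis (mono_tags, lifting) eventually_at_top_linorder order_refl less_imp_le)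
  ultimately have "e \<le> chi_square_quantile k \<alpha>"
    unfolding chi_square_quantile_def by (intro cInf_greatest) auto
  then show ?thesis using e(1) by linarith
qed

subsection \<open>The uniform distribution on an ellipsoid\<close>

text \<open>\<open>matrix_inv\<close> is a choice of two-sided inverse, so exhibiting the reciprocal
  diagonal matrix shows that the chosen one really inverts; its action is then read off
  coordinatewise.\<close>

lemma matrix_inv_diag_sq_mult:
  fixes \<sigma> :: "real ^ 'd::finite"
  assumes \<sigma>: "\<And>j. \<sigma> $ j \<noteq> 0"
  shows "(matrix_inv (diag_sq \<sigma>) *v v) $ i = v $ i / (\<sigma> $ i)\<^sup>2"
proof -
  let ?D = "diag_sq \<sigma>" and ?D' = "\<chi> i j. if i = j then 1 / (\<sigma> $ i)\<^sup>2 else 0 :: real ^ 'd ^ 'd"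
  have "?D ** ?D' = Finite_Cartesian_Product.mat 1" "?D' ** ?D = Finite_Cartesian_Product.mat 1"
    using \<sigma> by (simp_all add: diag_sq_def matrix_matrix_mult_def Finite_Cartesian_Product.mat_def vec_eq_iff
        if_distrib[of "\<lambda>a. a * _"] cong: if_cong)
  then have "\<exists>D'. ?D ** D' = Finite_Cartesian_Product.mat 1 \<and> D' ** ?D = Finite_Cartesian_Product.mat 1"
    by blast
  from someI_ex[OF this] have "?D ** matrix_inv ?D = Finite_Cartesian_Product.mat 1"
    unfolding matrix_inv_def by (rule conjunct1)
  then have "?D *v (matrix_inv ?D *v v) = v"
    by (simp add: matrix_vector_mul_assoc)
  then have "(?D *v (matrix_inv ?D *v v)) $ i = v $ i" by simp
  moreover have "(?D *v w) $ i = (\<sigma> $ i)\<^sup>2 * w $ i" for w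
    by (simp add: diag_sq_def matrix_vector_mult_def if_distrib[of "\<lambda>a. a * _"] cong: if_cong)
  ultimately show ?thesis using \<sigma>[of i] by (simp add: field_simps)
qed

lemma mem_ellipsoid_iff:
  fixes \<sigma> :: "real ^ 'd::finite"
  assumes \<sigma>: "\<And>j. \<sigma> $ j \<noteq> 0"
  shows "\<theta> \<in> ellipsoid \<mu> \<sigma> \<alpha> \<longleftrightarrow> (\<Sum>j\<in>UNIV. ((\<theta> - \<mu>) $ j / \<sigma> $ j)\<^sup>2) \<le> chi_square_quantile CARD('d) \<alpha>"
proof -
  have "(\<theta> - \<mu>) \<bullet> (matrix_inv (diag_sq \<sigma>) *v (\<theta> - \<mu>)) = (\<Sum>j\<in>UNIV. ((\<theta> - \<mu>) $ j / \<sigma> $ j)\<^sup>2)"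
    unfolding inner_vec_def
    by (intro sum.cong refl) (simp only: matrix_inv_diag_sq_mult[OF \<sigma>], simp add: power2_eq_square)
  then show ?thesis by (simp add: ellipsoid_def)
qed

text \<open>The scaling turns the quadratic form into \<open>q\<close> times the squared norm. The
  first form transforms indicator functions under the change of variables, the second yields
  compactness.\<close>

lemma ellipsoid_eq_image_cball:
  fixes \<sigma> \<mu> :: "real ^ 'd::finite"
  assumes \<sigma>: "\<And>j. \<sigma> $ j \<noteq> 0" and q: "q = chi_square_quantile CARD('d) \<alpha>" "q > 0"
  shows "\<mu> + (\<chi> j. (sqrt q * \<sigma> $ j) * x $ j) \<in> ellipsoid \<mu> \<sigma> \<alpha> \<longleftrightarrow> x \<in> cball 0 1"
    and "ellipsoid \<mu> \<sigma> \<alpha> = (\<lambda>x. \<mu> + (\<chi> j. (sqrt q * \<sigma> $ j) * x $ j)) ` cball 0 1"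
proof -
  let ?A = "\<lambda>x. \<mu> + (\<chi> j. (sqrt q * \<sigma> $ j) * x $ j)"
  show mem: "?A x \<in> ellipsoid \<mu> \<sigma> \<alpha> \<longleftrightarrow> x \<in> cball 0 1" for x
  proof -
    have "(\<Sum>j\<in>UNIV. ((?A x - \<mu>) $ j / \<sigma> $ j)\<^sup>2) = q * (\<Sum>j\<in>UNIV. (x $ j)\<^sup>2)"
      using \<sigma> q(2) by (simp add: sum_distrib_left power_mult_distrib)
    moreover have "x \<in> cball 0 1 \<longleftrightarrow> (\<Sum>j\<in>UNIV. (x $ j)\<^sup>2) \<le> 1"
      by (simp add: norm_vec_def L2_set_def real_sqrt_le_1_iff)
    ultimately show ?thesis
      using q by (simp add: mem_ellipsoid_iff[OF \<sigma>] mult_le_cancel_left1)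
  qed
  have "?A (\<chi> j. (\<theta> - \<mu>) $ j / (sqrt q * \<sigma> $ j)) = \<theta>" for \<theta>
    using \<sigma> q(2) by (simp add: vec_eq_iff)
  then have surj: "surj ?A" by (rule surjI)
  have vimage: "?A -` ellipsoid \<mu> \<sigma> \<alpha> = cball 0 1"
    by (simp only: vimage_def mem Collect_mem_eq)
  show "ellipsoid \<mu> \<sigma> \<alpha> = ?A ` cball 0 1"
    unfolding vimage[symmetric] using surj by (rule surj_image_vimage_eq[symmetric])
qed

text \<open>After centring, \<open>(L + (R - r))\<^sup>2\<close> is expanded and the square of
  \<open>R - r\<close> dropped. The term with \<open>r * L\<close> has mean zero, and only the cross
  term with \<open>R\<close> remains to be bounded.\<close>

lemma (in prob_space) variance_perturbation_ge:
  fixes L R :: "'a \<Rightarrow> real"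
  assumes [measurable]: "L \<in> borel_measurable M" "R \<in> borel_measurable M"
    and L: "\<And>x. x \<in> space M \<Longrightarrow> \<bar>L x\<bar> \<le> a" and R: "\<And>x. x \<in> space M \<Longrightarrow> \<bar>R x\<bar> \<le> \<rho>"
    and mean: "expectation L = 0"
    and g: "\<And>x. x \<in> space M \<Longrightarrow> g x = c + L x + R x"
  shows "variance g \<ge> expectation (\<lambda>x. (L x)\<^sup>2) - 2 * a * \<rho>"
proof -
  have bnd: "integrable M f" if "f \<in> borel_measurable M" "\<forall>x\<in>space M. \<bar>f x\<bar> \<le> B" for f :: "'a \<Rightarrow> real" and B
    using that by (intro integrable_const_bound[where B = B]) auto
  have iL: "integrable M L" using L by (intro bnd[of L a]) auto
  have iR: "integrable M R" using R by (intro bnd[of R \<rho>]) auto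
  have LR: "\<bar>L x * R x\<bar> \<le> a * \<rho>" if "x \<in> space M" for x
    using L[OF that] R[OF that] by (simp add: abs_mult mult_mono')
  have iLR: "integrable M (\<lambda>x. L x * R x)"
    using LR by (intro bnd[of _ "a * \<rho>"]) auto
  have iL2: "integrable M (\<lambda>x. (L x)\<^sup>2)"
  proof (rule bnd[of _ "a\<^sup>2"])
    show "\<forall>x\<in>space M. \<bar>(L x)\<^sup>2\<bar> \<le> a\<^sup>2"
      using power_mono[OF L abs_ge_zero, of _ 2] by simp
  qed simp
  define r where "r = expectation R"
  have "expectation g = expectation (\<lambda>x. c + L x + R x)"
    using g by (intro Bochner_Integration.integral_cong) auto
  also have "\<dots> = c + r"
    using iL iR mean by (simp add: r_def prob_space)
  finally have mg: "expectation g = c + r" .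
  have "variance g = expectation (\<lambda>x. (L x + (R x - r))\<^sup>2)"
    unfolding mg using g by (intro Bochner_Integration.integral_cong) (auto simp: algebra_simps)
  moreover have "expectation (\<lambda>x. (L x)\<^sup>2 + 2 * (L x * R x) - 2 * r * L x) \<le> expectation (\<lambda>x. (L x + (R x - r))\<^sup>2)"
  proof (rule integral_mono)
    have b: "\<bar>L x + (R x - r)\<bar> \<le> a + (\<rho> + \<bar>r\<bar>)" if "x \<in> space M" for x
      using L[OF that] R[OF that] by linarith
    show "integrable M (\<lambda>x. (L x + (R x - r))\<^sup>2)"
    proof (rule bnd[of _ "(a + (\<rho> + \<bar>r\<bar>))\<^sup>2"])
      show "\<forall>x\<in>space M. \<bar>(L x + (R x - r))\<^sup>2\<bar> \<le> (a + (\<rho> + \<bar>r\<bar>))\<^sup>2"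
        using power_mono[OF b abs_ge_zero, of _ 2] by simp
    qed simp
    show "(L x)\<^sup>2 + 2 * (L x * R x) - 2 * r * L x \<le> (L x + (R x - r))\<^sup>2" for x
      using zero_le_power2[of "R x - r"] by (simp add: power2_eq_square algebra_simps)
  qed (use iL iLR iL2 in auto)
  moreover have "expectation (\<lambda>x. (L x)\<^sup>2 + 2 * (L x * R x) - 2 * r * L x)
      = expectation (\<lambda>x. (L x)\<^sup>2) + 2 * expectation (\<lambda>x. L x * R x)"
    using iL iLR iL2 mean by simp
  moreover have "expectation (\<lambda>x. L x * R x) \<ge> - (a * \<rho>)"
  proof (rule integral_ge_const[OF iLR], rule AE_I2)
    show "- (a * \<rho>) \<le> L x * R x" if "x \<in> space M" for x
      using LR[OF that] by linarith
  qed
  ultimately show ?thesis by linarith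
qed

section \<open>Integration against the uniform distribution\<close>

lemma space_Unif [simp]: "space (Unif T) = T"
  by (simp add: Unif_def)

lemma
  fixes T :: "(real ^ 'd::finite) set"
  assumes T[measurable]: "T \<in> sets borel" and pos: "measure lborel T > 0"
  shows prob_space_Unif: "prob_space (Unif T)"
    and integral_Unif: "f \<in> borel_measurable borel \<Longrightarrow>
      integral\<^sup>L (Unif T) f = (\<integral>x. indicat_real T x * f x \<partial>lborel) / measure lborel T"
proof -
  \<comment> \<open>\<open>measure\<close> sends infinite volume to 0, so positivity implies
    finiteness.\<close>
  have fin: "emeasure lborel T \<noteq> \<infinity>" using pos by (auto simp: measure_def)
  have "emeasure (lebesgue_on T) T = emeasure lborel T"
    by (subst emeasure_restrict_space) auto
  then have e: "emeasure (lebesgue_on T) T = ennreal (measure lborel T)"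
    using emeasure_eq_ennreal_measure[of lborel T] fin by simp
  show "prob_space (Unif T)"
    unfolding Unif_def by (rule prob_space_uniform_measure) (use e pos in auto)
  assume f[measurable]: "f \<in> borel_measurable borel"
  have f': "f \<in> borel_measurable (lebesgue_on T)"
    by (intro measurable_restrict_space1 measurable_completion) simp
  have "Unif T = density (lebesgue_on T) (\<lambda>x. ennreal (indicator T x / measure lborel T))"
    unfolding Unif_def uniform_measure_def e using pos
    by (intro arg_cong[where f = "density _"] ext) (auto simp: indicator_def divide_ennreal ennreal_1[symmetric] simp del: ennreal_1)
  then have "integral\<^sup>L (Unif T) f = (\<integral>x. (indicator T x / measure lborel T) *\<^sub>R f x \<partial>lebesgue_on T)"
    using f' pos by (simp add: integral_density measurable_restrict_space1 measurable_completion)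
  also have "\<dots> = (\<integral>x. indicator T x *\<^sub>R ((indicator T x / measure lborel T) *\<^sub>R f x) \<partial>lebesgue)"
    by (rule integral_restrict_space) simp
  also have "\<dots> = (\<integral>x. indicator T x *\<^sub>R ((indicator T x / measure lborel T) *\<^sub>R f x) \<partial>lborel)"
    by (rule integral_completion) simp
  also have "\<dots> = (\<integral>x. (indicat_real T x * f x) / measure lborel T \<partial>lborel)"
    by (intro Bochner_Integration.integral_cong) (auto simp: indicator_def)
  finally show "integral\<^sup>L (Unif T) f = (\<integral>x. indicat_real T x * f x \<partial>lborel) / measure lborel T"
    by simp
qed

text \<open>The derivative of the objective is known to be continuous only near the ellipsoid, so
  its measurability must come from continuity on \<open>T\<close>.\<close>

lemma continuous_on_imp_borel_measurable_Unif:
  assumes "compact T" "continuous_on T f"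
  shows "f \<in> borel_measurable (Unif T)"
proof -
  have "f \<in> borel_measurable (lebesgue_on T)"
    using assms by (intro continuous_imp_measurable_on_sets_lebesgue) (auto simp: borel_compact)
  then show ?thesis
    by (simp add: Unif_def cong: measurable_cong_sets)
qed

lemma compact_ellipsoid:
  fixes \<mu> \<sigma> :: "real ^ 'd::finite"
  assumes "\<And>j. \<sigma> $ j \<noteq> 0" and "chi_square_quantile CARD('d) \<alpha> > 0"
  shows "compact (ellipsoid \<mu> \<sigma> \<alpha>)"
  unfolding ellipsoid_eq_image_cball(2)[OF assms(1) refl assms(2)]
  by (intro compact_continuous_image continuous_intros compact_cball)

text \<open>Both the volume and the integral pick up the constant Jacobian \<open>K\<close>, which
  cancels in the average. The volume is the case of the constant function 1.\<close>

lemma measure_ellipsoid_pos_and_integral: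
  fixes \<mu> \<sigma> :: "real ^ 'd::finite"
  assumes \<sigma>: "\<And>j. \<sigma> $ j \<noteq> 0" and q: "q = chi_square_quantile CARD('d) \<alpha>" "q > 0"
  shows measure_ellipsoid_pos: "measure lborel (ellipsoid \<mu> \<sigma> \<alpha>) > 0"
    and integral_Unif_ellipsoid: "continuous_on UNIV f \<Longrightarrow>
      integral\<^sup>L (Unif (ellipsoid \<mu> \<sigma> \<alpha>)) f =
      (\<integral>x. indicat_real (cball 0 1) x * f (\<mu> + (\<chi> j. (sqrt q * \<sigma> $ j) * x $ j)) \<partial>lborel)
        / measure lborel (cball (0 :: real ^ 'd) 1)"
proof -
  let ?T = "ellipsoid \<mu> \<sigma> \<alpha>" and ?B = "cball (0 :: real ^ 'd) 1"
  let ?A = "\<lambda>x. \<mu> + (\<chi> j. (sqrt q * \<sigma> $ j) * x $ j)"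
  define K where "K = (\<Prod>j\<in>UNIV. \<bar>sqrt q * \<sigma> $ j\<bar>)"
  have K: "K > 0" unfolding K_def using \<sigma> q(2) by (intro prod_pos) auto
  have T: "?T \<in> sets borel"
    using compact_ellipsoid[OF \<sigma>, of \<alpha> \<mu>] q by (simp add: borel_compact)
  have chg: "(\<integral>x. indicat_real ?T x * f x \<partial>lborel) = K * (\<integral>x. indicat_real ?B x * f (?A x) \<partial>lborel)"
    if f: "continuous_on UNIV f" for f
  proof -
    let ?c = "\<chi> j. sqrt q * \<sigma> $ j"
    have "(\<integral>x. indicat_real ?T x * f x \<partial>lborel) = (\<Prod>j\<in>UNIV. \<bar>?c $ j\<bar>) *
        (\<integral>x. indicat_real ?T (\<mu> + (\<chi> j. ?c $ j * x $ j)) * f (\<mu> + (\<chi> j. ?c $ j * x $ j)) \<partial>lborel)"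
      using \<sigma> q(2) T
      by (intro lborel_integral_affine_cart borel_measurable_times borel_measurable_indicator
          borel_measurable_continuous_onI f) auto
    moreover have "indicat_real ?T (?A x) = indicat_real ?B x" for x
      by (simp only: indicator_def ellipsoid_eq_image_cball(1)[OF \<sigma> q])
    ultimately show ?thesis by (simp add: K_def)
  qed
  have m: "measure lborel ?T = K * measure lborel ?B"
    using chg[of "\<lambda>_. 1"] T by simp
  then show pos: "measure lborel ?T > 0"
    using K content_cball_pos[of 1 "0 :: real ^ 'd"] by simp
  show "integral\<^sup>L (Unif ?T) f = (\<integral>x. indicat_real ?B x * f (?A x) \<partial>lborel) / measure lborel ?B"
    if f: "continuous_on UNIV f"
    using integral_Unif[OF T pos borel_measurable_continuous_onI[OF f]] chg[OF f] K by (simp add: m)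
qed

text \<open>Pulled back to the unit ball, the linear form has coefficients \<open>c j\<close>. Its
  mean vanishes with the first moments; in its square the mixed moments vanish and the diagonal ones
  are bounded below.\<close>

lemma
  fixes \<mu> \<sigma> h :: "real ^ 'd::finite"
  assumes \<sigma>: "\<And>j. \<sigma> $ j \<noteq> 0" and q: "q = chi_square_quantile CARD('d) \<alpha>" "q > 0"
  shows integral_Unif_ellipsoid_linear:
      "(\<integral>\<theta>. h \<bullet> (\<theta> - \<mu>) \<partial>Unif (ellipsoid \<mu> \<sigma> \<alpha>)) = 0"
    and integral_Unif_ellipsoid_linear_sq_ge:
      "(\<integral>\<theta>. (h \<bullet> (\<theta> - \<mu>))\<^sup>2 \<partial>Unif (ellipsoid \<mu> \<sigma> \<alpha>))
        \<ge> q * (\<Sum>j\<in>UNIV. (h $ j * \<sigma> $ j)\<^sup>2) / (real CARD('d) + 2)"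
proof -
  let ?T = "ellipsoid \<mu> \<sigma> \<alpha>" and ?B = "cball (0 :: real ^ 'd) 1"
  let ?V = "measure lborel ?B"
  have V: "?V > 0" by (rule content_cball_pos) simp
  define c where "c j = h $ j * (sqrt q * \<sigma> $ j)" for j
  have lin: "h \<bullet> (\<mu> + (\<chi> j. (sqrt q * \<sigma> $ j) * x $ j) - \<mu>) = (\<Sum>j\<in>UNIV. c j * x $ j)" for x
    by (simp add: inner_vec_def c_def mult_ac)
  have int: "integrable lborel (\<lambda>x. indicat_real ?B x * f x)" if "continuous_on UNIV f" for f :: "real ^ 'd \<Rightarrow> real"
    using borel_integrable_compact[OF compact_cball, of 0 1 f] continuous_on_subset[OF that] by simp
  have int1: "integrable lborel (\<lambda>x. indicat_real ?B x * x $ j)" for j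
    by (intro int continuous_intros)
  have int2: "integrable lborel (\<lambda>x. indicat_real ?B x * (x $ i * x $ j))" for i j
    by (intro int continuous_intros)
  have "(\<integral>x. indicat_real ?B x * (\<Sum>j\<in>UNIV. c j * x $ j) \<partial>lborel)
      = (\<integral>x. (\<Sum>j\<in>UNIV. c j * (indicat_real ?B x * x $ j)) \<partial>lborel)"
    by (simp add: sum_distrib_left mult_ac)
  also have "\<dots> = (\<Sum>j\<in>UNIV. c j * (\<integral>x. indicat_real ?B x * x $ j \<partial>lborel))"
    using int1 by (subst Bochner_Integration.integral_sum) simp_all
  finally have "(\<integral>x. indicat_real ?B x * (\<Sum>j\<in>UNIV. c j * x $ j) \<partial>lborel) = 0"
    by (simp add: unit_ball_first_moment)
  then show "(\<integral>\<theta>. h \<bullet> (\<theta> - \<mu>) \<partial>Unif ?T) = 0"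
    by (subst integral_Unif_ellipsoid[OF \<sigma> q]) (auto simp only: lin intro!: continuous_intros)
  have "(\<integral>x. indicat_real ?B x * (\<Sum>j\<in>UNIV. c j * x $ j)\<^sup>2 \<partial>lborel)
      = (\<integral>x. (\<Sum>i\<in>UNIV. \<Sum>j\<in>UNIV. c i * c j * (indicat_real ?B x * (x $ i * x $ j))) \<partial>lborel)"
    by (simp add: power2_eq_square sum_product sum_distrib_left mult_ac)
  also have "\<dots> = (\<Sum>i\<in>UNIV. \<Sum>j\<in>UNIV. c i * c j * (\<integral>x. indicat_real ?B x * (x $ i * x $ j) \<partial>lborel))"
    using int2 by (subst Bochner_Integration.integral_sum, simp)+ simp
  also have "\<dots> = (\<Sum>i\<in>UNIV. \<Sum>j\<in>UNIV. if j = i then (c i)\<^sup>2 * (\<integral>x. indicat_real ?B x * (x $ i)\<^sup>2 \<partial>lborel) else 0)"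
    by (intro sum.cong refl) (simp add: unit_ball_mixed_moment power2_eq_square)
  also have "\<dots> = (\<Sum>i\<in>UNIV. (c i)\<^sup>2 * (\<integral>x. indicat_real ?B x * (x $ i)\<^sup>2 \<partial>lborel))"
    by simp
  also have "\<dots> \<ge> (\<Sum>i\<in>UNIV. (c i)\<^sup>2 * (?V / (real CARD('d) + 2)))"
    by (intro sum_mono mult_left_mono unit_ball_second_moment_ge) simp
  finally have "(\<Sum>i\<in>UNIV. (c i)\<^sup>2 * (?V / (real CARD('d) + 2)))
      \<le> (\<integral>x. indicat_real ?B x * (\<Sum>j\<in>UNIV. c j * x $ j)\<^sup>2 \<partial>lborel)" .
  moreover have "(\<Sum>i\<in>UNIV. (c i)\<^sup>2 * (?V / (real CARD('d) + 2)))
      = q * (\<Sum>j\<in>UNIV. (h $ j * \<sigma> $ j)\<^sup>2) / (real CARD('d) + 2) * ?V"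
    using q(2) by (simp add: c_def power_mult_distrib sum_distrib_left sum_distrib_right sum_divide_distrib mult_ac)
  ultimately have "q * (\<Sum>j\<in>UNIV. (h $ j * \<sigma> $ j)\<^sup>2) / (real CARD('d) + 2)
      \<le> (\<integral>x. indicat_real ?B x * (\<Sum>j\<in>UNIV. c j * x $ j)\<^sup>2 \<partial>lborel) / ?V"
    using V by (simp only: pos_le_divide_eq)
  then show "(\<integral>\<theta>. (h \<bullet> (\<theta> - \<mu>))\<^sup>2 \<partial>Unif ?T) \<ge> q * (\<Sum>j\<in>UNIV. (h $ j * \<sigma> $ j)\<^sup>2) / (real CARD('d) + 2)"
    by (subst integral_Unif_ellipsoid[OF \<sigma> q]) (auto simp only: lin intro!: continuous_intros)
qed

subsection \<open>The variance of a partial derivative\<close>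

lemma norm_ellipsoid_le:
  fixes \<mu> \<sigma> :: "real ^ 'd::finite"
  assumes \<sigma>: "\<And>j. \<sigma> $ j > 0" "\<And>j. \<sigma> $ j \<le> s" and \<theta>: "\<theta> \<in> ellipsoid \<mu> \<sigma> \<alpha>"
  shows "(norm (\<theta> - \<mu>))\<^sup>2 \<le> s\<^sup>2 * chi_square_quantile CARD('d) \<alpha>"
proof -
  have "(norm (\<theta> - \<mu>))\<^sup>2 = (\<Sum>j\<in>UNIV. ((\<theta> - \<mu>) $ j)\<^sup>2)"
    by (simp add: norm_vec_def L2_set_def sum_nonneg)
  also have "\<dots> \<le> (\<Sum>j\<in>UNIV. s\<^sup>2 * ((\<theta> - \<mu>) $ j / \<sigma> $ j)\<^sup>2)"
  proof (intro sum_mono)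
    fix j
    have "((\<theta> - \<mu>) $ j)\<^sup>2 = (\<sigma> $ j)\<^sup>2 * ((\<theta> - \<mu>) $ j / \<sigma> $ j)\<^sup>2"
      using \<sigma>(1)[of j] by (simp add: power_divide)
    also have "\<dots> \<le> s\<^sup>2 * ((\<theta> - \<mu>) $ j / \<sigma> $ j)\<^sup>2"
      using \<sigma>(1)[of j] \<sigma>(2)[of j] by (intro mult_right_mono power_mono) auto
    finally show "((\<theta> - \<mu>) $ j)\<^sup>2 \<le> s\<^sup>2 * ((\<theta> - \<mu>) $ j / \<sigma> $ j)\<^sup>2" .
  qed
  also have "\<dots> = s\<^sup>2 * (\<Sum>j\<in>UNIV. ((\<theta> - \<mu>) $ j / \<sigma> $ j)\<^sup>2)"
    by (rule sum_distrib_left[symmetric])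
  also have "\<dots> \<le> s\<^sup>2 * chi_square_quantile CARD('d) \<alpha>"
    using mem_ellipsoid_iff[of \<sigma> \<theta> \<mu> \<alpha>] \<sigma>(1) \<theta> by (intro mult_left_mono) (auto simp: less_imp_neq[symmetric])
  finally show ?thesis .
qed

text \<open>The estimate for a general function in any dimension, with the error constant
  explicit.\<close>

lemma variance_partial_deriv_ge:
  fixes F :: "real ^ 'd::finite \<Rightarrow> real" and \<mu> \<sigma> :: "real ^ 'd"
  assumes \<sigma>: "\<And>j. \<sigma> $ j > 0" and U: "open U" "ellipsoid \<mu> \<sigma> \<alpha> \<subseteq> U"
    and F: "Ck_on 3 F U"
    and \<kappa>: "lambda_min (- hessian F \<mu>) \<ge> \<kappa>" "\<kappa> > 0"
    and M3: "\<And>\<theta> i j k. \<theta> \<in> U \<Longrightarrow> \<bar>partial_deriv i (partial_deriv j (partial_deriv k F)) \<theta>\<bar> \<le> M3"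
    and q: "q = chi_square_quantile CARD('d) \<alpha>" "q > 0"
    and s: "0 \<le> smin" "\<And>j. smin \<le> \<sigma> $ j" "\<And>j. \<sigma> $ j \<le> smax"
  shows "prob_space.variance (Unif (ellipsoid \<mu> \<sigma> \<alpha>)) (partial_deriv j F)
    \<ge> \<kappa>\<^sup>2 * smin\<^sup>2 * q / (real CARD('d) + 2)
      - real CARD('d) * q * sqrt q * (onorm ((*v) (hessian F \<mu>)) * M3 * smax ^ 3)"
proof -
  let ?T = "ellipsoid \<mu> \<sigma> \<alpha>" and ?H = "hessian F \<mu>" and ?g = "partial_deriv j F"
  let ?d = "real CARD('d)"
  define \<Lambda> where "\<Lambda> = onorm ((*v) ?H)"
  have \<sigma>0: "\<sigma> $ j \<noteq> 0" for j using \<sigma>[of j] by simp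
  have diff: "F differentiable_on U" "partial_deriv i F differentiable_on U"
    "partial_deriv k (partial_deriv i F) differentiable_on U" for i k
    using F by (auto simp: numeral_3_eq_3)
  \<comment> \<open>The ellipsoid is star-shaped about \<open>\<mu>\<close>: shrinking by
    \<open>t\<close> multiplies the quadratic form by \<open>t\<^sup>2\<close>. This keeps the
    Taylor segments inside \<open>U\<close>.\<close>
  have seg: "\<mu> + t *\<^sub>R v \<in> ?T" if "\<mu> + v \<in> ?T" "0 \<le> t" "t \<le> 1" for t v
  proof -
    have "(\<Sum>j\<in>UNIV. ((\<mu> + t *\<^sub>R v - \<mu>) $ j / \<sigma> $ j)\<^sup>2) \<le> (\<Sum>j\<in>UNIV. ((\<mu> + v - \<mu>) $ j / \<sigma> $ j)\<^sup>2)"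
    proof (rule sum_mono)
      fix i
      have "t\<^sup>2 \<le> 1" using that by (simp add: power_le_one)
      then show "((\<mu> + t *\<^sub>R v - \<mu>) $ i / \<sigma> $ i)\<^sup>2 \<le> ((\<mu> + v - \<mu>) $ i / \<sigma> $ i)\<^sup>2"
        by (simp add: power_mult_distrib power_divide divide_right_mono mult_left_le_one_le)
    qed
    then show ?thesis
      using that(1) unfolding mem_ellipsoid_iff[OF \<sigma>0] by linarith
  qed
  have \<mu>: "\<mu> \<in> ?T"
    using q by (simp add: mem_ellipsoid_iff[OF \<sigma>0])
  then have \<mu>U: "\<mu> \<in> U" using U by blast
  have M3_nonneg: "M3 \<ge> 0"
    using M3[OF \<mu>U, of j j j] by linarith
  have sym: "(- ?H) $ i $ k = (- ?H) $ k $ i" for i k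
    using partial_deriv_commute[OF U(1) \<mu>U diff(1,2), of i k]
    by (simp add: hessian_def differentiable_imp_continuous_on[OF diff(3)])
  define h where "h = (\<chi> k. partial_deriv k ?g \<mu>)"
  have h: "h = column j ?H"
    by (simp add: h_def column_def hessian_def)
  have h\<Lambda>: "norm h \<le> \<Lambda>"
    unfolding h \<Lambda>_def by (rule norm_column_le_onorm)
  \<comment> \<open>Testing the quadratic form of the negated Hessian on the \<open>j\<close>-th
    unit vector isolates the diagonal entry \<open>- (h $ j)\<close>.\<close>
  have "\<kappa> \<le> lambda_min (- ?H) * (axis j 1 \<bullet> (axis j 1 :: real ^ 'd))"
    using \<kappa> by (simp add: inner_axis)
  also have "\<dots> \<le> axis j 1 \<bullet> (- ?H *v axis j 1)"
    by (rule lambda_min_le_quadratic_form[OF sym])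
  also have "\<dots> = - (h $ j)"
    by (simp add: inner_axis' matrix_vector_mult_basis h column_def)
  also have "\<dots> \<le> norm h"
    using component_le_norm_cart[of h j] by linarith
  finally have h\<kappa>: "\<kappa> \<le> norm h" .
  have smax: "smax \<ge> 0" using \<sigma>[of j] s(3)[of j] by linarith
  have nT: "norm (\<theta> - \<mu>) \<le> smax * sqrt q" if "\<theta> \<in> ?T" for \<theta>
  proof (rule power2_le_imp_le)
    show "(norm (\<theta> - \<mu>))\<^sup>2 \<le> (smax * sqrt q)\<^sup>2"
      using norm_ellipsoid_le[OF \<sigma> s(3) that] q by (simp add: power_mult_distrib)
  qed (use smax q in simp)
  define L where "L \<theta> = h \<bullet> (\<theta> - \<mu>)" for \<theta>
  define R where "R \<theta> = ?g \<theta> - ?g \<mu> - L \<theta>" for \<theta>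
  define \<rho> where "\<rho> = M3 * ?d * (smax\<^sup>2 * q) / 2"
  have L: "\<bar>L \<theta>\<bar> \<le> \<Lambda> * (smax * sqrt q)" if "\<theta> \<in> ?T" for \<theta>
  proof -
    have "\<bar>L \<theta>\<bar> \<le> norm h * norm (\<theta> - \<mu>)"
      unfolding L_def by (rule Cauchy_Schwarz_ineq2)
    also have "\<dots> \<le> \<Lambda> * (smax * sqrt q)"
      using h\<Lambda> nT[OF that] order_trans[OF norm_ge_zero h\<Lambda>] by (intro mult_mono) auto
    finally show ?thesis .
  qed
  have R: "\<bar>R \<theta>\<bar> \<le> \<rho>" if \<theta>: "\<theta> \<in> ?T" for \<theta>
  proof -
    \<comment> \<open>The second partial derivatives of \<open>?g\<close> are third ones of
      \<open>F\<close>, hence bounded by \<open>M3\<close>.\<close>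
    have "\<bar>?g (\<mu> + (\<theta> - \<mu>)) - ?g \<mu> - (\<Sum>k\<in>UNIV. (\<theta> - \<mu>) $ k * partial_deriv k ?g \<mu>)\<bar>
        \<le> M3 * ?d * (norm (\<theta> - \<mu>))\<^sup>2 / 2"
    proof (rule first_order_taylor_bound[OF U(1) diff(2,3)])
      show "\<mu> + t *\<^sub>R (\<theta> - \<mu>) \<in> U" if "0 \<le> t" "t \<le> 1" for t
        using seg[of "\<theta> - \<mu>" t] that \<theta> U(2) by auto
    qed (rule M3)
    moreover have "M3 * ?d * (norm (\<theta> - \<mu>))\<^sup>2 \<le> M3 * ?d * (smax\<^sup>2 * q)"
      using norm_ellipsoid_le[OF \<sigma> s(3) \<theta>] M3_nonneg q by (intro mult_left_mono) auto
    ultimately show ?thesis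
      by (simp add: R_def L_def \<rho>_def h_def inner_vec_def mult.commute[of "partial_deriv _ _ _"])
  qed
  have pos: "measure lborel ?T > 0" by (rule measure_ellipsoid_pos[OF \<sigma>0 q])
  have compact: "compact ?T" using compact_ellipsoid[OF \<sigma>0] q by simp
  have gT: "continuous_on ?T ?g"
    using differentiable_imp_continuous_on[OF diff(2)] U(2) by (rule continuous_on_subset)
  interpret prob_space "Unif ?T"
    by (rule prob_space_Unif[OF _ pos]) (use compact in \<open>simp add: borel_compact\<close>)
  have "variance ?g \<ge> expectation (\<lambda>\<theta>. (L \<theta>)\<^sup>2) - 2 * (\<Lambda> * (smax * sqrt q)) * \<rho>"
  proof (rule variance_perturbation_ge[where R = R and c = "?g \<mu>"])
    show "L \<in> borel_measurable (Unif ?T)" "R \<in> borel_measurable (Unif ?T)"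
      unfolding R_def[abs_def] L_def[abs_def]
      by (intro continuous_on_imp_borel_measurable_Unif[OF compact] continuous_intros gT)+
    show "expectation L = 0"
      unfolding L_def[abs_def] by (rule integral_Unif_ellipsoid_linear[OF \<sigma>0 q])
  qed (use L R in \<open>auto simp: R_def\<close>)
  moreover have "expectation (\<lambda>\<theta>. (L \<theta>)\<^sup>2) \<ge> \<kappa>\<^sup>2 * smin\<^sup>2 * q / (?d + 2)"
  proof -
    have "\<kappa>\<^sup>2 * smin\<^sup>2 \<le> (norm h)\<^sup>2 * smin\<^sup>2"
      using h\<kappa> \<kappa>(2) by (intro mult_right_mono power_mono) auto
    also have "\<dots> = (\<Sum>i\<in>UNIV. (h $ i * smin)\<^sup>2)"
      by (simp add: norm_vec_def L2_set_def sum_nonneg sum_distrib_right power_mult_distrib)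
    also have "\<dots> \<le> (\<Sum>i\<in>UNIV. (h $ i * \<sigma> $ i)\<^sup>2)"
      using s(1,2) by (intro sum_mono) (auto simp: power_mult_distrib intro!: mult_left_mono power_mono)
    finally have "q * (\<kappa>\<^sup>2 * smin\<^sup>2) / (?d + 2) \<le> q * (\<Sum>i\<in>UNIV. (h $ i * \<sigma> $ i)\<^sup>2) / (?d + 2)"
      using q(2) by (intro divide_right_mono mult_left_mono) auto
    also have "\<dots> \<le> expectation (\<lambda>\<theta>. (L \<theta>)\<^sup>2)"
      unfolding L_def by (rule integral_Unif_ellipsoid_linear_sq_ge[OF \<sigma>0 q])
    finally show ?thesis by (simp add: mult_ac)
  qed
  moreover have "2 * (\<Lambda> * (smax * sqrt q)) * \<rho> = ?d * q * sqrt q * (\<Lambda> * M3 * smax ^ 3)"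
    by (simp add: \<rho>_def power2_eq_square power3_eq_cube)
  ultimately show ?thesis by (simp only: \<Lambda>_def)
qed

theorem theorem4:
  fixes \<alpha> :: real
  assumes "0 < \<alpha>" and "\<alpha> < 1"
  shows "\<exists>C :: real. \<forall>(n :: nat) (E :: nat set set)
      (\<mu> :: real ^ ('p::{finite,linorder} + 'p)) (\<sigma> :: real ^ ('p + 'p)) (\<kappa> :: real) (M3 :: real)
      (U :: (real ^ ('p + 'p)) set).
    simple_graph n E \<longrightarrow>
    (\<forall>j. vec_nth \<sigma> j > 0) \<longrightarrow>
    open U \<longrightarrow> ellipsoid \<mu> \<sigma> \<alpha> \<subseteq> U \<longrightarrow>
    Ck_on 3 (qaoa_objective n E) U \<longrightarrow>
    lambda_min (- hessian (qaoa_objective n E) \<mu>) \<ge> \<kappa> \<longrightarrow> \<kappa> > 0 \<longrightarrow>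
    (\<forall>\<theta>\<in>U. \<forall>i j k.
       \<bar>partial_deriv i (partial_deriv j (partial_deriv k (qaoa_objective n E))) \<theta>\<bar> \<le> M3) \<longrightarrow>
    (let \<Lambda> = onorm ((*v) (hessian (qaoa_objective n E) \<mu>));
         \<sigma>_min = Min (range (vec_nth \<sigma>));
         \<sigma>_max = Max (range (vec_nth \<sigma>))
     in \<forall>j. prob_space.variance (Unif (ellipsoid \<mu> \<sigma> \<alpha>)) (partial_deriv j (qaoa_objective n E))
          \<ge> \<kappa>\<^sup>2 * \<sigma>_min\<^sup>2 * chi_square_quantile (2 * CARD('p)) \<alpha> / (2 * real CARD('p) + 2)
             - C * (\<Lambda> * M3 * \<sigma>_max ^ 3 + M3\<^sup>2 * \<sigma>_max ^ 4))"
proof -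
  have card: "CARD('p + 'p) = 2 * CARD('p)" by (simp add: card_UNIV_sum)
  define q where "q = chi_square_quantile CARD('p + 'p) \<alpha>"
  have q: "q > 0" unfolding q_def using assms by (intro chi_square_quantile_pos) (simp_all add: card)
  have q_card: "q = chi_square_quantile (2 * CARD('p)) \<alpha>" unfolding q_def card ..
  have real_card: "real CARD('p + 'p) = 2 * real CARD('p)" by (simp add: card)
  \<comment> \<open>The order-three error constant of \<open>variance_partial_deriv_ge\<close>; it
    depends only on the depth and on \<open>\<alpha>\<close>.\<close>
  define C where "C = real CARD('p + 'p) * q * sqrt q"
  have C: "C \<ge> 0" using q by (simp add: C_def)
  show ?thesis
    unfolding Let_def
  proof (intro exI[of _ C] allI impI, goal_cases)
    case (1 n E \<mu> \<sigma> \<kappa> M3 U j)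
    let ?smin = "Min (range (vec_nth \<sigma>))" and ?smax = "Max (range (vec_nth \<sigma>))"
    have "0 \<le> ?smin" using 1(2) by (auto simp: less_imp_le)
    then have "prob_space.variance (Unif (ellipsoid \<mu> \<sigma> \<alpha>)) (partial_deriv j (qaoa_objective n E))
      \<ge> \<kappa>\<^sup>2 * ?smin\<^sup>2 * q / (real CARD('p + 'p) + 2)
        - C * (onorm ((*v) (hessian (qaoa_objective n E) \<mu>)) * M3 * ?smax ^ 3)"
      unfolding C_def using 1(2,8)
      by (intro variance_partial_deriv_ge[OF _ 1(3-7) _ q_def q]) auto
    \<comment> \<open>Subtracting this nonnegative term as well only lowers the bound.\<close>
    moreover have "0 \<le> C * (M3\<^sup>2 * ?smax ^ 4)" using C by simp
    ultimately show ?case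
      unfolding q_card real_card distrib_left by linarith
  qed
qed

end
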